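(* For every integer $n\geq 1$ there exist $n$ distinct points $p_1,\dots,p_n\in\mathbb{R}^2$ and a regular solution $\phi:\mathbb{R}^2\setminus\{p_1,\dots,p_n\}\to\mathbb{R}$ to $$\phi_{xx}\phi_{yy}-\phi_{xy}^2=1,$$ globally defined in $\mathbb{R}^2\setminus\{p_1,\dots,p_n\}$, such that the points $p_1,\dots,p_n$ are non-removable isolated singularities of $\phi$.
   Context: A regular solution is a $\mathcal{C}^2$ function satisfying the equation at every point of its domain. An isolated singularity $p_j$ of a solution $\phi$ is non-removable if $\phi$ cannot be extended as a $\mathcal{C}^1$ function across $p_j$. *)

theory Defs
  imports "HOL-Analysis.Analysis"
begin

text \<open>
  The plane is \<^typ>\<open>real \<times> real\<close>. A function on an open set \<open>U\<close> of the plane is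
  represented by a total function whose values outside \<open>U\<close> are irrelevant: all derivatives
  at a point depend only on the values near that point.
\<close>

definition partial_x :: "(real \<times> real \<Rightarrow> real) \<Rightarrow> real \<times> real \<Rightarrow> real" where
  "partial_x f = (\<lambda>(x, y). deriv (\<lambda>t. f (t, y)) x)"

definition partial_y :: "(real \<times> real \<Rightarrow> real) \<Rightarrow> real \<times> real \<Rightarrow> real" where
  "partial_y f = (\<lambda>(x, y). deriv (\<lambda>t. f (x, t)) y)"

text \<open>
  The existence of the partial derivatives has to be required separately, since \<^const>\<open>deriv\<close>
  is total. Continuity of \<open>f\<close> itself follows from that of its partial derivatives.
\<close>

definition C1_on :: "(real \<times> real \<Rightarrow> real) \<Rightarrow> (real \<times> real) set \<Rightarrow> bool" where
  "C1_on f U \<longleftrightarrow> open U \<and>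
     (\<forall>(x, y)\<in>U. (\<lambda>t. f (t, y)) field_differentiable (at x) \<and>
                 (\<lambda>t. f (x, t)) field_differentiable (at y)) \<and>
     continuous_on U (partial_x f) \<and> continuous_on U (partial_y f)"

definition C2_on :: "(real \<times> real \<Rightarrow> real) \<Rightarrow> (real \<times> real) set \<Rightarrow> bool" where
  "C2_on f U \<longleftrightarrow> C1_on f U \<and> C1_on (partial_x f) U \<and> C1_on (partial_y f) U"

definition regular_solution :: "(real \<times> real \<Rightarrow> real) \<Rightarrow> (real \<times> real) set \<Rightarrow> bool" where
  "regular_solution \<phi> U \<longleftrightarrow> C2_on \<phi> U \<and>
     (\<forall>q\<in>U. partial_x (partial_x \<phi>) q * partial_y (partial_y \<phi>) q
              - (partial_y (partial_x \<phi>) q)\<^sup>2 = 1)"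

definition isolated_singularity :: "(real \<times> real \<Rightarrow> real) \<Rightarrow> real \<times> real \<Rightarrow> bool" where
  "isolated_singularity \<phi> p \<longleftrightarrow> (\<exists>r>0. regular_solution \<phi> (ball p r - {p}))"

text \<open>
  The neighbourhood \<open>V\<close> may be arbitrarily small, and the value of the total function \<open>\<phi>\<close> at
  \<open>p\<close> plays no role.
\<close>

definition C1_extends_across :: "(real \<times> real \<Rightarrow> real) \<Rightarrow> real \<times> real \<Rightarrow> bool" where
  "C1_extends_across \<phi> p \<longleftrightarrow>
     (\<exists>V \<psi>. p \<in> V \<and> C1_on \<psi> V \<and> (\<forall>q\<in>V - {p}. \<psi> q = \<phi> q))"

definition nonremovable_isolated_singularity ::
    "(real \<times> real \<Rightarrow> real) \<Rightarrow> real \<times> real \<Rightarrow> bool" where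
  "nonremovable_isolated_singularity \<phi> p \<longleftrightarrow>
     isolated_singularity \<phi> p \<and> \<not> C1_extends_across \<phi> p"

end

theory Submission
  imports Defs "HOL-Complex_Analysis.Complex_Analysis"
begin

text \<open>
  By the partial Legendre transform in \<open>x\<close>, a solution is encoded by a holomorphic function \<open>A\<close> of
  \<open>z = \<phi>\<^sub>x + \<i> y\<close> with \<open>A = x + \<i> \<phi>\<^sub>y\<close> and \<open>Re A' > 0\<close>. We take \<open>z\<close> in the plane slit along the \<open>n\<close>
  intervals \<open>[2j, 2j + 1]\<close> of the real axis and look for an \<open>A\<close> that is real on the gaps and has constant
  real part \<open>x\<^sub>j\<close> on the \<open>j\<close>-th slit; the slit then collapses to the single point \<open>(x\<^sub>j, 0)\<close>, where
  \<open>\<phi>\<^sub>x\<close> jumps from \<open>2j\<close> to \<open>2j + 1\<close>. Such an \<open>A\<close> is a primitive of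
  \<open>\<Prod>(z - c\<^sub>j) / \<surd>(\<Prod>(z - k))\<close> (the \<open>k\<close> ranging over the \<open>2n\<close> end points), provided its increments along
  all slits vanish. These are \<open>n\<close> linear conditions on the \<open>n + 1\<close> coefficients of the numerator, and
  by Rolle any nonzero solution has a zero \<open>c\<^sub>j\<close> in each slit. This interlacing with the end points
  yields \<open>Re A' > 0\<close>, so that \<open>z \<mapsto> (Re A, Im z)\<close> is a diffeomorphism from the slit plane onto
  the plane without the points \<open>(x\<^sub>j, 0)\<close>, and \<open>\<phi> = x \<phi>\<^sub>x - Re W\<close> with \<open>W' = A\<close> is the desired solution.
\<close>

subsection \<open>Primitives on the closed upper half plane\<close>

abbreviation open_half :: "complex set" where
  "open_half \<equiv> {z. 0 < Im z}"

abbreviation closed_half :: "complex set" where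
  "closed_half \<equiv> {z. 0 \<le> Im z}"

text \<open>Seen from the real centre \<open>c\<close>, a segment to a point of
  \<open>open_half\<close> enters \<open>open_half\<close> at once, and the ball is convex. Starlike
  sets have primitives, which is how an interior primitive is carried across a boundary
  point.\<close>

lemma starlike_half_Un_ball:
  assumes "Im c = 0" "r > 0"
  shows "starlike (open_half \<union> ball c r)"
  unfolding starlike_def
proof (intro bexI ballI subsetI)
  show "c \<in> open_half \<union> ball c r" using assms by simp
  fix z w assume z: "z \<in> open_half \<union> ball c r" and w: "w \<in> closed_segment c z"
  show "w \<in> open_half \<union> ball c r"
  proof (cases "z \<in> ball c r")
    case True
    then have "closed_segment c z \<subseteq> ball c r"
      using assms by (intro closed_segment_subset) auto
    with w show ?thesis by blast
  next
    case False
    with z have "Im z > 0" by simp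
    obtain u where u: "0 \<le> u" "w = (1 - u) *\<^sub>R c + u *\<^sub>R z"
      using w by (auto simp: in_segment)
    show ?thesis
    proof (cases "u = 0")
      case True
      then show ?thesis using u assms by simp
    next
      case False
      then show ?thesis using u assms \<open>Im z > 0\<close> by simp
    qed
  qed
qed

text \<open>The inverse square root is integrable: integrating \<open>C / sqrt (Im z + s)\<close>
  over \<open>s\<close> from \<open>e\<close> to \<open>d\<close> gives a bound that is independent
  of \<open>z\<close> and tends to 0 with \<open>d\<close>.\<close>

lemma primitive_vertical_bound:
  assumes A: "\<And>w. Im w > 0 \<Longrightarrow> (A has_field_derivative G w) (at w)"
    and C: "\<And>w. Im w > 0 \<Longrightarrow> norm w \<le> M + 1 \<Longrightarrow> norm (G w) \<le> C / sqrt (Im w)"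
    and z: "Im z \<ge> 0" "norm z \<le> M" and e: "0 < e" "e \<le> d" "d \<le> 1"
    and "C \<ge> 0"
  shows "norm (A (z + of_real d * \<i>) - A (z + of_real e * \<i>)) \<le> 2 * C * sqrt d"
proof (cases "e = d")
  case True
  then show ?thesis using e \<open>C \<ge> 0\<close> by simp
next
  case False
  with e have "e < d" by simp
  have deriv: "((\<lambda>s. A (z + of_real s * \<i>)) has_vector_derivative (\<i> * G (z + of_real s * \<i>))) (at s)"
    if "s > 0" for s
  proof -
    have "((\<lambda>s. z + of_real s * \<i>) has_vector_derivative \<i>) (at s)"
      by (auto intro!: derivative_eq_intros)
    from field_vector_diff_chain_at[OF this, of A "G (z + of_real s * \<i>)"] A z that
    show ?thesis by (simp add: o_def)
  qed
  have "norm (A (z + of_real d * \<i>) - A (z + of_real e * \<i>))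
     \<le> 2 * C * sqrt (Im z + d) - 2 * C * sqrt (Im z + e)"
  proof (rule differentiable_bound_general[OF \<open>e < d\<close>, where f = "\<lambda>s. A (z + of_real s * \<i>)" and \<phi> = "\<lambda>s. 2 * C * sqrt (Im z + s)"])
    show "continuous_on {e..d} (\<lambda>s. A (z + of_real s * \<i>))"
      using e by (intro continuous_at_imp_continuous_on ballI has_vector_derivative_continuous[OF deriv]) auto
    show "continuous_on {e..d} (\<lambda>s. 2 * C * sqrt (Im z + s))"
      by (intro continuous_intros)
    fix s assume s: "e < s" "s < d"
    show "((\<lambda>s. A (z + of_real s * \<i>)) has_vector_derivative (\<i> * G (z + of_real s * \<i>))) (at s)"
      using deriv s e by auto
    show "((\<lambda>s. 2 * C * sqrt (Im z + s)) has_vector_derivative C / sqrt (Im z + s)) (at s)"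
      unfolding has_real_derivative_iff_has_vector_derivative[symmetric]
      using s e z by (auto intro!: derivative_eq_intros simp: field_simps)
    have "norm (z + of_real s * \<i>) \<le> norm z + norm (of_real s * \<i> :: complex)"
      by (rule norm_triangle_ineq)
    also have "\<dots> \<le> M + 1"
      using z s e by (simp add: norm_mult)
    finally show "norm (\<i> * G (z + of_real s * \<i>)) \<le> C / sqrt (Im z + s)"
      using C[of "z + of_real s * \<i>"] z s e by (simp add: norm_mult)
  qed
  also have "\<dots> \<le> 2 * C * sqrt d"
  proof -
    have "sqrt (Im z + d) \<le> sqrt (Im z + e) + sqrt d"
      using z e by (intro order_trans[OF _ sqrt_add_le_add_sqrt]) auto
    then have "(2 * C) * sqrt (Im z + d) \<le> (2 * C) * (sqrt (Im z + e) + sqrt d)"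
      using \<open>C \<ge> 0\<close> by (intro mult_left_mono) auto
    then show ?thesis by (simp add: algebra_simps)
  qed
  finally show ?thesis .
qed

text \<open>Boundary values are limits of an interior primitive along vertical shifts. By
  \<open>primitive_vertical_bound\<close> the convergence is uniform on bounded sets, so
  \<open>A\<close> is continuous on the whole axis, including axis points outside
  \<open>D\<close>.\<close>

lemma primitive_closed_half:
  fixes G :: "complex \<Rightarrow> complex"
  assumes "open D" and sub: "open_half \<subseteq> D" and G: "G holomorphic_on D"
    and bound: "\<And>M. \<exists>C. \<forall>z. Im z > 0 \<longrightarrow> norm z \<le> M \<longrightarrow> norm (G z) \<le> C / sqrt (Im z)"
  obtains A where "continuous_on closed_half A"
    "\<And>z. z \<in> closed_half \<inter> D \<Longrightarrow> (A has_field_derivative G z) (at z within closed_half)"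
proof -
  have "convex open_half" "open open_half"
    by (auto simp: convex_halfspace_Im_gt open_halfspace_Im_gt)
  moreover have "G holomorphic_on open_half"
    using G sub holomorphic_on_subset by blast
  ultimately obtain A0 where A0': "\<And>z. z \<in> open_half \<Longrightarrow> (A0 has_field_derivative G z) (at z within open_half)"
    using holomorphic_convex_primitive' by metis
  then have A0: "\<And>z. Im z > 0 \<Longrightarrow> (A0 has_field_derivative G z) (at z)"
    using at_within_open[OF _ \<open>open open_half\<close>] by (metis mem_Collect_eq)
  define \<epsilon> where "\<epsilon> m = inverse (real (Suc m))" for m
  have \<epsilon>: "0 < \<epsilon> m" "\<epsilon> m \<le> 1" "m \<le> k \<Longrightarrow> \<epsilon> k \<le> \<epsilon> m" for m k
    by (auto simp: \<epsilon>_def inverse_le_1_iff intro!: le_imp_inverse_le)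
  have \<epsilon>0: "\<epsilon> \<longlonglongrightarrow> 0"
    unfolding \<epsilon>_def by (rule LIMSEQ_inverse_real_of_nat)
  define f where "f m z = A0 (z + of_real (\<epsilon> m) * \<i>)" for m z
  define S where "S M = closed_half \<inter> cball 0 M" for M :: real
  have conv: "uniformly_convergent_on (S M) f" for M
    unfolding uniformly_convergent_eq_Cauchy uniformly_Cauchy_on_def
  proof (intro allI impI)
    fix e :: real assume "e > 0"
    \<comment> \<open>A vertical shift by at most 1 increases the norm by at most 1, hence
      \<open>M + 1\<close>.\<close>
    obtain C0 where C0: "\<And>z. Im z > 0 \<Longrightarrow> norm z \<le> M + 1 \<Longrightarrow> norm (G z) \<le> C0 / sqrt (Im z)"
      using bound by blast
    define C where "C = \<bar>C0\<bar> + 1"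
    have C: "norm (G z) \<le> C / sqrt (Im z)" if "Im z > 0" "norm z \<le> M + 1" for z
    proof -
      have "C0 / sqrt (Im z) \<le> C / sqrt (Im z)"
        unfolding C_def using that by (intro divide_right_mono) auto
      with C0[OF that] show ?thesis by linarith
    qed
    have "C > 0" by (simp add: C_def)
    have "(\<lambda>m. 2 * C * sqrt (\<epsilon> m)) \<longlonglongrightarrow> 2 * C * sqrt 0"
      by (intro tendsto_intros \<epsilon>0)
    then have "eventually (\<lambda>m. 2 * C * sqrt (\<epsilon> m) < e) sequentially"
      using \<open>e > 0\<close> by (intro order_tendstoD(2)) auto
    then obtain N where N: "\<And>m. m \<ge> N \<Longrightarrow> 2 * C * sqrt (\<epsilon> m) < e"
      by (auto simp: eventually_sequentially)
    have *: "dist (f m z) (f k z) < e" if "z \<in> S M" "N \<le> m" "m \<le> k" for m k z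
    proof -
      have "dist (f m z) (f k z) \<le> 2 * C * sqrt (\<epsilon> m)"
        unfolding f_def dist_norm
        by (rule primitive_vertical_bound[where G = G and M = M])
           (use A0 C \<epsilon> that \<open>C > 0\<close> in \<open>auto simp: S_def\<close>)
      with N[OF \<open>N \<le> m\<close>] show ?thesis by linarith
    qed
    show "\<exists>N. \<forall>z\<in>S M. \<forall>m\<ge>N. \<forall>k\<ge>N. dist (f m z) (f k z) < e"
    proof (intro exI ballI allI impI)
      fix z m k assume "z \<in> S M" "N \<le> m" "N \<le> k"
      then show "dist (f m z) (f k z) < e"
        using *[of z m k] *[of z k m] by (cases "m \<le> k") (auto simp: dist_commute)
    qed
  qed
  define A where "A z = lim (\<lambda>m. f m z)" for z
  have unif: "uniform_limit (S M) f A sequentially" for M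
    using conv[of M] unfolding A_def uniformly_convergent_uniform_limit_iff .
  have lim: "(\<lambda>m. f m z) \<longlonglongrightarrow> A z" if "Im z \<ge> 0" for z
    by (rule tendsto_uniform_limitI[OF unif[of "norm z"]]) (use that in \<open>auto simp: S_def\<close>)
  have shift: "(\<lambda>m. z + of_real (\<epsilon> m) * \<i>) \<longlonglongrightarrow> z" for z
    by (auto intro!: tendsto_eq_intros \<epsilon>0)
  have contA: "continuous_on closed_half A"
    unfolding continuous_on_eq_continuous_within
  proof
    fix z assume z: "z \<in> closed_half"
    define M where "M = norm z + 1"
    have "continuous_on (S M) A"
    proof (rule uniform_limit_theorem[OF _ unif])
      show "\<forall>\<^sub>F m in sequentially. continuous_on (S M) (f m)"
      proof (intro always_eventually allI)
        fix m
        have "continuous_on open_half A0"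
          using A0 by (intro continuous_at_imp_continuous_on ballI DERIV_isCont) auto
        then have "continuous_on (S M) (A0 \<circ> (\<lambda>z. z + of_real (\<epsilon> m) * \<i>))"
          by (intro continuous_on_compose continuous_intros, elim continuous_on_subset)
             (auto simp: S_def intro!: add_nonneg_pos \<epsilon>)
        then show "continuous_on (S M) (f m)" by (simp add: f_def o_def)
      qed
    qed auto
    then have "continuous (at z within S M) A"
      using z by (auto simp: continuous_on_eq_continuous_within S_def M_def)
    moreover have "at z within S M = at z within closed_half"
      by (rule at_within_nhd[of _ "ball 0 M"]) (auto simp: S_def M_def)
    ultimately show "continuous (at z within closed_half) A" by simp
  qed
  have eqA: "A z = A0 z" if "Im z > 0" for z
  proof -
    have "(\<lambda>m. f m z) \<longlonglongrightarrow> A0 z"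
      unfolding f_def
      by (rule isCont_tendsto_compose[OF DERIV_isCont[OF A0[OF that]] shift])
    then show ?thesis using lim[of z] that LIMSEQ_unique by force
  qed
  have "(A has_field_derivative G z) (at z within closed_half)" if z: "z \<in> closed_half \<inter> D" for z
  proof (cases "Im z > 0")
    case True
    have "(A has_field_derivative G z) (at z)"
      by (rule has_field_derivative_transform_within_open[OF A0[OF True] \<open>open open_half\<close>])
         (use True eqA in auto)
    then show ?thesis by (rule has_field_derivative_at_within)
  next
    case False
    with z have "Im z = 0" by simp
    obtain r where r: "r > 0" "ball z r \<subseteq> D"
      using z \<open>open D\<close> openE by blast
    \<comment> \<open>On \<open>V\<close> there is a primitive \<open>A1\<close> on both sides of
      the axis. It differs from \<open>A0\<close> by a constant above the axis, and the limit of
      shifts extends this to the axis, so \<open>A\<close> inherits the derivative of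
      \<open>A1\<close> at \<open>z\<close>.\<close>
    define V where "V = open_half \<union> ball z r"
    have V: "open V" "V \<subseteq> D" "starlike V"
      using \<open>open open_half\<close> r sub starlike_half_Un_ball[OF \<open>Im z = 0\<close>] by (auto simp: V_def)
    then have hol: "G holomorphic_on V" using G holomorphic_on_subset by blast
    have "\<exists>g. \<forall>x\<in>V. (g has_field_derivative G x) (at x)"
      by (rule holomorphic_starlike_primitive[where k = "{}"])
         (use V hol in \<open>auto intro: holomorphic_on_imp_continuous_on holomorphic_on_imp_differentiable_at\<close>)
    then obtain A1 where A1: "\<And>x. x \<in> V \<Longrightarrow> (A1 has_field_derivative G x) (at x)" by blast
    have "\<exists>k. \<forall>w\<in>open_half. A0 w - A1 w = k"
    proof (rule has_field_derivative_zero_constant[OF \<open>convex open_half\<close>])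
      fix w assume w: "w \<in> open_half"
      then have "((\<lambda>w. A0 w - A1 w) has_field_derivative (G w - G w)) (at w)"
        using A0 A1 by (intro DERIV_diff) (auto simp: V_def)
      then show "((\<lambda>w. A0 w - A1 w) has_field_derivative 0) (at w within open_half)"
        by (simp add: has_field_derivative_at_within)
    qed
    then obtain k where k: "\<And>w. Im w > 0 \<Longrightarrow> A0 w = A1 w + k"
      by (auto simp: algebra_simps)
    have eq1: "A1 w + k = A w" if w: "Im w \<ge> 0" "w \<in> V" for w
    proof -
      have "(\<lambda>m. A1 (w + of_real (\<epsilon> m) * \<i>)) \<longlonglongrightarrow> A1 w"
        by (rule isCont_tendsto_compose[OF DERIV_isCont[OF A1[OF w(2)]] shift])
      then have "(\<lambda>m. A1 (w + of_real (\<epsilon> m) * \<i>) + k) \<longlonglongrightarrow> A1 w + k"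
        by (intro tendsto_intros)
      moreover have "A1 (w + of_real (\<epsilon> m) * \<i>) + k = f m w" for m
        using w \<epsilon>(1)[of m] k[of "w + of_real (\<epsilon> m) * \<i>"] by (simp add: f_def)
      ultimately show ?thesis using lim[OF w(1)] LIMSEQ_unique by force
    qed
    have "((\<lambda>w. A1 w + k) has_field_derivative G z) (at z within closed_half)"
      using DERIV_add[OF A1[of z] DERIV_const[of k]] r by (auto intro: has_field_derivative_at_within simp: V_def)
    then show ?thesis
      by (rule has_field_derivative_transform_within[OF _ r(1)])
         (use z eq1 in \<open>auto simp: V_def dist_commute\<close>)
  qed
  with contA show ?thesis by (rule that)
qed

subsection \<open>The numerator and its zeros\<close>

text \<open>Gaussian elimination, removing one equation and one unknown at a time.\<close>

lemma nontrivial_kernel: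
  fixes M :: "'a \<Rightarrow> 'b \<Rightarrow> real"
  assumes "finite J" "finite I" "card J < card I"
  shows "\<exists>c. (\<exists>i\<in>I. c i \<noteq> 0) \<and> (\<forall>j\<in>J. (\<Sum>i\<in>I. M j i * c i) = 0)"
  using assms
proof (induction J arbitrary: M I rule: finite_induct)
  case empty
  then obtain i where "i \<in> I" by fastforce
  then show ?case by (intro exI[of _ "\<lambda>_. 1"]) auto
next
  case (insert j J)
  show ?case
  proof (cases "\<forall>i\<in>I. M j i = 0")
    case True
    obtain c where "\<exists>i\<in>I. c i \<noteq> 0" "\<forall>j\<in>J. (\<Sum>i\<in>I. M j i * c i) = 0"
      using insert.IH[of I M] insert.prems insert.hyps by auto
    with True show ?thesis by (intro exI[of _ c]) auto
  next
    case False
    then obtain k where k: "k \<in> I" "M j k \<noteq> 0" by blast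
    define I' where "I' = I - {k}"
    have I': "finite I'" "card J < card I'" "I = insert k I'" "k \<notin> I'"
      using insert k by (auto simp: I'_def)
    \<comment> \<open>Equation \<open>j\<close> with pivot \<open>M j k\<close> eliminates the
      unknown \<open>k\<close> from the others; \<open>d\<close> recovers this unknown by back
      substitution.\<close>
    define M' where "M' l i = M l i - M j i * M l k / M j k" for l i
    obtain c where c: "\<exists>i\<in>I'. c i \<noteq> 0" "\<forall>l\<in>J. (\<Sum>i\<in>I'. M' l i * c i) = 0"
      using insert.IH[of I' M'] I' by auto
    define d where "d = c(k := - (\<Sum>i\<in>I'. M j i * c i) / M j k)"
    have sum_d: "(\<Sum>i\<in>I. M l i * d i) = (\<Sum>i\<in>I'. M' l i * c i)" for l
    proof -
      have "(\<Sum>i\<in>I'. M l i * d i) = (\<Sum>i\<in>I'. M l i * c i)"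
        using I' by (intro sum.cong) (auto simp: d_def)
      then have "(\<Sum>i\<in>I. M l i * d i) = (\<Sum>i\<in>I'. M l i * c i) - (\<Sum>i\<in>I'. M j i * c i) * (M l k / M j k)"
        using I' by (simp add: d_def)
      also have "\<dots> = (\<Sum>i\<in>I'. M' l i * c i)"
        unfolding M'_def sum_distrib_right sum_subtractf[symmetric]
        by (intro sum.cong refl) (simp add: algebra_simps)
      finally show ?thesis .
    qed
    have "M' j i = 0" for i using k by (simp add: M'_def)
    then have "\<forall>l\<in>insert j J. (\<Sum>i\<in>I. M l i * d i) = 0"
      using c(2) by (simp add: sum_d)
    moreover have "\<exists>i\<in>I. d i \<noteq> 0"
      using c(1) I' by (auto simp: d_def)
    ultimately show ?thesis by blast
  qed
qed

text \<open>
  The cut is put on the negative imaginary axis so that \<open>ulog\<close> is holomorphic near every nonzero real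
  point.
\<close>

definition ulog :: "complex \<Rightarrow> complex" where
  "ulog z = Ln (- \<i> * z) + \<i> * of_real (pi / 2)"

lemma exp_ulog: "z \<noteq> 0 \<Longrightarrow> exp (ulog z) = z"
  by (simp add: ulog_def exp_add cis_pi_half mult.commute[of z] mult.assoc del: of_real_divide flip: cis_conv_exp)

lemma holomorphic_on_ulog: "ulog holomorphic_on {z. Re z \<noteq> 0 \<or> Im z > 0}"
  unfolding ulog_def by (intro holomorphic_intros) (auto simp: complex_nonpos_Reals_iff)

text \<open>Written with \<open>arctan\<close>, the argument visibly depends monotonically on the
  real part and stays strictly between 0 and \<pi>.\<close>

lemma Im_ulog:
  assumes "Im z > 0"
  shows "Im (ulog z) = pi / 2 - arctan (Re z / Im z)"
proof -
  have "z \<noteq> 0" using assms by auto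
  then have "Im (Ln (- \<i> * z)) = Arg (- \<i> * z)"
    using Arg_eq_Im_Ln by simp
  also have "\<dots> = arctan (Im (- \<i> * z) / Re (- \<i> * z))"
    by (rule arg_conv_arctan) (use assms in simp)
  finally show ?thesis by (simp add: ulog_def arctan_minus)
qed

text \<open>A branch of the square root of the product of all \<open>z - k\<close> with
  \<open>k < 2 * n\<close>, fixed by halving a sum of logarithms.\<close>

definition root_prod :: "nat \<Rightarrow> complex \<Rightarrow> complex" where
  "root_prod n z = exp ((\<Sum>k<2 * n. ulog (z - of_nat k)) / 2)"

lemma root_prod_nonzero [simp]: "root_prod n z \<noteq> 0"
  by (simp add: root_prod_def)

lemma root_prod_square:
  assumes "z \<notin> of_nat ` {..<2 * n}"
  shows "(root_prod n z)\<^sup>2 = (\<Prod>k<2 * n. z - of_nat k)"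
proof -
  have "(root_prod n z)\<^sup>2 = exp (\<Sum>k<2 * n. ulog (z - of_nat k))"
    by (simp add: root_prod_def flip: exp_double)
  also have "\<dots> = (\<Prod>k<2 * n. exp (ulog (z - of_nat k)))"
    by (simp add: exp_sum)
  also have "\<dots> = (\<Prod>k<2 * n. z - of_nat k)"
    using assms by (intro prod.cong refl exp_ulog) auto
  finally show ?thesis .
qed

text \<open>The plane without the vertical rays going down from the branch points, which are the
  cuts of the logarithms in \<open>root_prod\<close>. It contains the open upper half plane and
  every real point that is not a branch point.\<close>

definition root_domain :: "nat \<Rightarrow> complex set" where
  "root_domain n = {z. \<forall>k<2 * n. Re z \<noteq> real k \<or> Im z > 0}"

lemma open_root_domain: "open (root_domain n)"
proof -
  have "root_domain n = (\<Inter>k\<in>{..<2 * n}. {z. Re z \<noteq> real k} \<union> {z. Im z > 0})"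
    by (auto simp: root_domain_def)
  moreover have "open {z. Re z \<noteq> real k}" for k
    by (intro open_Collect_neq continuous_intros)
  ultimately show ?thesis
    by (auto intro!: open_INT open_Un open_halfspace_Im_gt)
qed

lemma closed_half_Int_root_domain:
  "closed_half \<inter> root_domain n = closed_half - of_nat ` {..<2 * n}"
  by (force simp: root_domain_def complex_eq_iff image_iff)

lemma holomorphic_on_root_prod: "root_prod n holomorphic_on root_domain n"
  unfolding root_prod_def
  by (intro holomorphic_intros holomorphic_on_compose_gen[OF _ holomorphic_on_ulog, unfolded o_def])
     (auto simp: root_domain_def)

text \<open>Only the nearest of the integers can be close to \<open>z\<close>, and its distance is
  at least \<open>\<bar>Im z\<bar>\<close>. The others are at least 1/2 away, since distinct
  integers are at least 1 apart.\<close>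

lemma norm_prod_integers_ge:
  fixes z :: complex
  assumes "N \<ge> 1"
  shows "norm (\<Prod>k<N. z - of_nat k) \<ge> \<bar>Im z\<bar> * (1 / 2) ^ N"
proof -
  define k0 where "k0 = arg_min_on (\<lambda>k. norm (z - of_nat k)) {..<N}"
  have ne: "finite {..<N}" "{..<N} \<noteq> {}" using assms by (auto simp: set_eq_iff intro: exI[of _ 0])
  have k0: "k0 < N" "\<And>k. k < N \<Longrightarrow> norm (z - of_nat k0) \<le> norm (z - of_nat k)"
    using arg_min_if_finite(1)[OF ne, of "\<lambda>k. norm (z - of_nat k)"] arg_min_least[OF ne, of _ "\<lambda>k. norm (z - of_nat k)"]
    by (auto simp: k0_def)
  have far: "1 / 2 \<le> norm (z - of_nat k)" if "k < N" "k \<noteq> k0" for k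
  proof -
    have "1 \<le> \<bar>int k - int k0\<bar>" using that by linarith
    then have "1 \<le> \<bar>real k - real k0\<bar>" by linarith
    also have "\<dots> = norm (complex_of_real (real k - real k0))"
      by (simp only: norm_of_real)
    also have "complex_of_real (real k - real k0) = (z - of_nat k0) - (z - of_nat k)" by simp
    also have "norm \<dots> \<le> norm (z - of_nat k0) + norm (z - of_nat k)"
      by (rule norm_triangle_ineq4)
    finally show ?thesis using k0(2)[OF \<open>k < N\<close>] by simp
  qed
  have "(1 / 2) ^ N \<le> (1 / 2 :: real) ^ (N - 1)"
    by (intro power_decreasing) auto
  also have "\<dots> = (\<Prod>k\<in>{..<N} - {k0}. 1 / 2)"
    using k0 by simp
  also have "\<dots> \<le> (\<Prod>k\<in>{..<N} - {k0}. norm (z - of_nat k))"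
    using far by (intro prod_mono) auto
  finally have "(1 / 2) ^ N \<le> (\<Prod>k\<in>{..<N} - {k0}. norm (z - of_nat k))" .
  moreover have "\<bar>Im z\<bar> \<le> norm (z - of_nat k0)"
    using abs_Im_le_cmod[of "z - of_nat k0"] by simp
  ultimately have "\<bar>Im z\<bar> * (1 / 2) ^ N \<le> norm (z - of_nat k0) * (\<Prod>k\<in>{..<N} - {k0}. norm (z - of_nat k))"
    by (intro mult_mono) auto
  also have "\<dots> = norm (\<Prod>k<N. z - of_nat k)"
    using k0 by (simp add: prod.remove[of "{..<N}" k0] norm_mult prod_norm)
  finally show ?thesis .
qed

text \<open>Supplies the inverse square root bound that \<open>primitive_closed_half\<close> asks
  for; it is the square root of \<open>norm_prod_integers_ge\<close> for \<open>2 * n\<close>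
  factors.\<close>

lemma norm_root_prod_ge:
  assumes "n \<ge> 1" "Im z > 0"
  shows "norm (root_prod n z) \<ge> sqrt (Im z) * (1 / 2) ^ n"
proof -
  have "z \<notin> of_nat ` {..<2 * n}" using assms by auto
  then have "(norm (root_prod n z))\<^sup>2 = norm (\<Prod>k<2 * n. z - of_nat k)"
    by (simp add: root_prod_square flip: norm_power)
  also have "\<dots> \<ge> \<bar>Im z\<bar> * (1 / 2) ^ (2 * n)"
    using assms by (intro norm_prod_integers_ge) auto
  finally have "(sqrt (Im z) * (1 / 2) ^ n)\<^sup>2 \<le> (norm (root_prod n z))\<^sup>2"
    using assms by (simp add: power_mult_distrib flip: power_mult) (simp add: mult.commute)
  then show ?thesis
    by (rule power2_le_imp_le) simp
qed

text \<open>A separate primitive for each monomial turns conditions on the numerator into linear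
  equations for its coefficients.\<close>

lemma monomial_over_root_primitive:
  assumes "n \<ge> 1"
  obtains A where "continuous_on closed_half A"
    "\<And>z. z \<in> closed_half - of_nat ` {..<2 * n} \<Longrightarrow>
       (A has_field_derivative z ^ i / root_prod n z) (at z within closed_half)"
proof (rule primitive_closed_half[where G = "\<lambda>z. z ^ i / root_prod n z" and D = "root_domain n"])
  show "open_half \<subseteq> root_domain n" by (auto simp: root_domain_def)
  show "(\<lambda>z. z ^ i / root_prod n z) holomorphic_on root_domain n"
    by (intro holomorphic_intros holomorphic_on_root_prod) auto
  fix M
  show "\<exists>C. \<forall>z. 0 < Im z \<longrightarrow> norm z \<le> M \<longrightarrow> norm (z ^ i / root_prod n z) \<le> C / sqrt (Im z)"
  proof (intro exI allI impI)
    fix z assume z: "0 < Im z" "norm z \<le> M"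
    have "norm (z ^ i / root_prod n z) \<le> M ^ i / (sqrt (Im z) * (1 / 2) ^ n)"
      unfolding norm_divide norm_power using z norm_root_prod_ge[OF assms z(1)] order_trans[OF norm_ge_zero z(2)]
      by (intro frac_le power_mono zero_le_power) auto
    then show "norm (z ^ i / root_prod n z) \<le> M ^ i * 2 ^ n / sqrt (Im z)"
      by (simp add: field_simps power_divide)
  qed
qed (use that open_root_domain in \<open>auto simp: closed_half_Int_root_domain\<close>)

text \<open>A horizontal line at height \<open>y \<ge> 0\<close> stays in
  \<open>closed_half\<close>, so a derivative within the half plane gives a two-sided derivative
  along the line, even on the axis.\<close>

lemma horizontal_deriv:
  assumes "(A has_field_derivative d) (at (Complex t y) within closed_half)" "y \<ge> 0"
  shows "((\<lambda>s. Re (A (Complex s y))) has_real_derivative Re d) (at t)"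
    and "((\<lambda>s. Im (A (Complex s y))) has_real_derivative Im d) (at t)"
proof -
  have "((\<lambda>s. of_real s + \<i> * of_real y) has_vector_derivative 1) (at t)"
    by (auto intro!: derivative_eq_intros)
  then have 1: "((\<lambda>s. Complex s y) has_vector_derivative 1) (at t)"
    by (simp add: Complex_eq)
  have "(A has_field_derivative d) (at (Complex t y) within (\<lambda>s. Complex s y) ` UNIV)"
    using assms by (elim DERIV_subset) auto
  from field_vector_diff_chain_within[OF 1 this]
  have v: "((\<lambda>s. A (Complex s y)) has_vector_derivative d) (at t)"
    by (simp add: o_def)
  show "((\<lambda>s. Re (A (Complex s y))) has_real_derivative Re d) (at t)"
    "((\<lambda>s. Im (A (Complex s y))) has_real_derivative Im d) (at t)"
    unfolding has_real_derivative_iff_has_vector_derivative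
    using bounded_linear.has_vector_derivative[OF bounded_linear_Re v]
      bounded_linear.has_vector_derivative[OF bounded_linear_Im v] by auto
qed

section \<open>Signs of the radicand on slits and gaps\<close>

lemma prod_pairs: "(\<Prod>k<2 * n. f k) = (\<Prod>j<n. f (2 * j) * f (2 * j + 1))"
  for f :: "nat \<Rightarrow> 'a::comm_monoid_mult"
  by (induction n) (simp_all add: mult.assoc)

definition slits :: "nat \<Rightarrow> complex set" where
  "slits n = {z. Im z = 0 \<and> (\<exists>j<n. 2 * real j \<le> Re z \<and> Re z \<le> 2 * real j + 1)}"

lemma integer_in_slits: "k < 2 * n \<Longrightarrow> of_nat k \<in> slits n"
  by (cases "even k") (auto simp: slits_def elim!: evenE oddE intro!: exI[of _ "k div 2"])

lemma not_slit_not_integer: "z \<notin> slits n \<Longrightarrow> z \<notin> of_nat ` {..<2 * n}"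
  using integer_in_slits by auto

lemma open_slit_not_integer:
  assumes "2 * real j < t" "t < 2 * real j + 1"
  shows "Complex t 0 \<notin> of_nat ` N"
proof
  assume "Complex t 0 \<in> of_nat ` N"
  then obtain k where "t = real k" by (auto simp: complex_eq_iff)
  with assms have "2 * j < k" "k < 2 * j + 1" by linarith+
  then show False by simp
qed

text \<open>The radicand of \<open>root_prod\<close> at a real point, with the two ends of each slit
  paired: a pair is negative exactly in the interior of its slit.\<close>

definition pair_prod :: "nat \<Rightarrow> real \<Rightarrow> real" where
  "pair_prod n t = (\<Prod>j<n. (t - 2 * real j) * (t - (2 * real j + 1)))"

lemma root_prod_real_square:
  assumes "Complex t 0 \<notin> of_nat ` {..<2 * n}"
  shows "(root_prod n (Complex t 0))\<^sup>2 = of_real (pair_prod n t)"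
  unfolding root_prod_square[OF assms] prod_pairs pair_prod_def
  by (simp add: complex_of_real_def[symmetric] of_real_prod add.commute)

lemma pair_prod_pos:
  assumes "Complex t 0 \<notin> slits n"
  shows "pair_prod n t > 0"
  unfolding pair_prod_def
proof (intro prod_pos)
  fix j assume "j \<in> {..<n}"
  with assms have "t < 2 * real j \<or> t > 2 * real j + 1" by (auto simp: slits_def not_le)
  then show "0 < (t - 2 * real j) * (t - (2 * real j + 1))"
    by (auto intro: mult_pos_pos mult_neg_neg)
qed

lemma pair_prod_neg:
  assumes "j < n" "2 * real j < t" "t < 2 * real j + 1"
  shows "pair_prod n t < 0"
proof -
  have "0 < (\<Prod>i\<in>{..<n} - {j}. (t - 2 * real i) * (t - (2 * real i + 1)))"
  proof (intro prod_pos)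
    fix i assume "i \<in> {..<n} - {j}"
    then have "i < j \<or> j < i" by auto
    then have "t < 2 * real i \<or> t > 2 * real i + 1" using assms by auto
    then show "0 < (t - 2 * real i) * (t - (2 * real i + 1))"
      by (auto intro: mult_pos_pos mult_neg_neg)
  qed
  moreover have "(t - 2 * real j) * (t - (2 * real j + 1)) < 0"
    using assms by (intro mult_pos_neg) auto
  ultimately show ?thesis
    using assms by (simp add: pair_prod_def prod.remove[of "{..<n}" j] mult_neg_pos)
qed

text \<open>A complex number with positive real square is real. Likewise
  \<open>root_prod_slit\<close> holds because a negative real square forces a purely imaginary
  number.\<close>

lemma root_prod_gap:
  assumes "Complex t 0 \<notin> slits n"
  shows "Im (root_prod n (Complex t 0)) = 0"
  using root_prod_real_square[OF not_slit_not_integer[OF assms]] pair_prod_pos[OF assms]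
  by (auto simp: complex_eq_iff power2_eq_square zero_less_mult_iff) (smt (verit) zero_le_square)

lemma root_prod_slit:
  assumes "j < n" "2 * real j < t" "t < 2 * real j + 1"
  shows "Re (root_prod n (Complex t 0)) = 0"
  using root_prod_real_square[OF open_slit_not_integer[OF assms(2,3)], of n] pair_prod_neg[OF assms]
  by (auto simp: complex_eq_iff power2_eq_square mult_less_0_iff) (smt (verit) zero_le_square)

text \<open>With real coefficients the integrand is imaginary on the slits, so only the imaginary
  increment along each slit must be made to vanish. A nonzero solution of these equations is then
  normalized to a monic numerator and to the value 0 at 0.\<close>

lemma slit_map_primitive:
  assumes "n \<ge> 1"
  obtains B c where "\<And>j. j < n \<Longrightarrow> 2 * real j < c j \<and> c j < 2 * real j + 1"
    "continuous_on closed_half B" "B 0 = 0"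
    "\<And>z. z \<in> closed_half - of_nat ` {..<2 * n} \<Longrightarrow>
       (B has_field_derivative (\<Prod>j<n. z - of_real (c j)) / root_prod n z) (at z within closed_half)"
    "\<And>j. j < n \<Longrightarrow> Im (B (of_nat (2 * j + 1))) = Im (B (of_nat (2 * j)))"
proof -
  have "\<forall>i. \<exists>A. continuous_on closed_half A \<and> (\<forall>z \<in> closed_half - of_nat ` {..<2 * n}.
      (A has_field_derivative z ^ i / root_prod n z) (at z within closed_half))"
    using monomial_over_root_primitive[OF assms] by metis
  then obtain A where A: "\<And>i. continuous_on closed_half (A i)"
    "\<And>i z. z \<in> closed_half - of_nat ` {..<2 * n} \<Longrightarrow>
      (A i has_field_derivative z ^ i / root_prod n z) (at z within closed_half)"
    by metis
  \<comment> \<open>The imaginary increment of the \<open>i\<close>-th primitive along the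
    \<open>j\<close>-th slit.\<close>
  define M where "M j i = Im (A i (of_nat (2 * j + 1))) - Im (A i (of_nat (2 * j)))" for i j
  obtain a where a: "\<exists>i\<in>{..n}. a i \<noteq> 0" "\<And>j. j < n \<Longrightarrow> (\<Sum>i\<le>n. M j i * a i) = 0"
    using nontrivial_kernel[of "{..<n}" "{..n}" M] by auto
  define p :: "complex poly" where "p = (\<Sum>i\<le>n. monom (of_real (a i)) i)"
  have poly_p: "poly p z = (\<Sum>i\<le>n. of_real (a i) * z ^ i)" for z
    by (simp add: p_def poly_sum poly_monom)
  have coeff_p: "coeff p k = (if k \<le> n then of_real (a k) else 0)" for k
    by (simp add: p_def coeff_sum)
  have "p \<noteq> 0" using a(1) coeff_p by (metis atMost_iff coeff_0 of_real_eq_0_iff)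
  have "degree p \<le> n" by (rule degree_le) (simp add: coeff_p)
  define B where "B z = (\<Sum>i\<le>n. of_real (a i) * A i z)" for z
  have contB: "continuous_on closed_half B"
    unfolding B_def by (intro continuous_intros A)
  have B': "(B has_field_derivative poly p z / root_prod n z) (at z within closed_half)"
    if "z \<in> closed_half - of_nat ` {..<2 * n}" for z
  proof -
    have "(B has_field_derivative (\<Sum>i\<le>n. of_real (a i) * (z ^ i / root_prod n z))) (at z within closed_half)"
      unfolding B_def by (intro DERIV_sum DERIV_cmult A that)
    then show ?thesis by (simp add: poly_p sum_divide_distrib)
  qed
  have ImB: "Im (B (of_nat (2 * j + 1))) = Im (B (of_nat (2 * j)))" if "j < n" for j
    using a(2)[OF that] by (simp add: B_def M_def algebra_simps sum_subtractf)
  have "\<exists>c. 2 * real j < c \<and> c < 2 * real j + 1 \<and> poly p (of_real c) = 0" if "j < n" for j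
  proof -
    define f where "f t = Im (B (Complex t 0))" for t
    define d where "d t = Im (poly p (of_real t) / root_prod n (Complex t 0))" for t
    have f': "(f has_real_derivative d t) (at t)" if "2 * real j < t" "t < 2 * real j + 1" for t
      unfolding f_def d_def using B'[of "Complex t 0"] open_slit_not_integer[OF that]
      by (intro horizontal_deriv(2)) (simp_all add: complex_of_real_def)
    have "\<exists>c. 2 * real j < c \<and> c < 2 * real j + 1 \<and> (f has_real_derivative 0) (at c)"
    proof (rule Rolle)
      have "of_nat m = Complex (real m) 0" for m by (simp add: complex_eq_iff)
      then show "f (2 * real j) = f (2 * real j + 1)"
        using ImB[OF \<open>j < n\<close>] by (simp add: f_def add.commute)
      have "continuous_on {2 * real j..2 * real j + 1} (B \<circ> (\<lambda>t. Complex t 0))"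
        by (intro continuous_on_compose continuous_on_subset[OF contB] continuous_intros) auto
      then show "continuous_on {2 * real j..2 * real j + 1} f"
        unfolding f_def o_def by (intro continuous_intros)
      show "f differentiable at t" if "2 * real j < t" "t < 2 * real j + 1" for t
        using f'[OF that] by (auto simp: real_differentiable_def)
    qed simp
    then obtain c where c: "2 * real j < c" "c < 2 * real j + 1" "(f has_real_derivative 0) (at c)"
      by blast
    then have "d c = 0" using f' DERIV_unique by blast
    \<comment> \<open>The numerator is real and the denominator imaginary and nonzero, so a
      vanishing imaginary part of the quotient forces the numerator to vanish.\<close>
    have "poly p (of_real c) = of_real (\<Sum>i\<le>n. a i * c ^ i)" by (simp add: poly_p)
    then obtain P :: real where "poly p (of_real c) = of_real P" by blast
    moreover obtain s where "root_prod n (Complex c 0) = \<i> * of_real s"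
      using root_prod_slit[OF \<open>j < n\<close> c(1,2)] by (metis complex_eq add_0 of_real_0)
    moreover from this have "s \<noteq> 0" using root_prod_nonzero[of n "Complex c 0"] by auto
    ultimately have "poly p (of_real c) = 0"
      using \<open>d c = 0\<close> by (simp add: d_def Im_divide power2_eq_square)
    with c show ?thesis by blast
  qed
  then obtain c where c: "\<And>j. j < n \<Longrightarrow> 2 * real j < c j \<and> c j < 2 * real j + 1"
    "\<And>j. j < n \<Longrightarrow> poly p (of_real (c j)) = 0"
    by metis
  \<comment> \<open>\<open>p\<close> and \<open>q\<close> agree at \<open>n\<close> distinct points
    and in the coefficient of degree \<open>n\<close>, hence coincide. As \<open>p\<close> is
    nonzero, so is this coefficient, and it can be divided out.\<close>
  define q :: "complex poly" where "q = smult (coeff p n) (\<Prod>j<n. [:- of_real (c j), 1:])"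
  have monic: "lead_coeff (\<Prod>j<n. [:- of_real (c j), 1 :: complex:]) = 1"
    by (simp add: lead_coeff_prod)
  have deg: "degree (\<Prod>j<n. [:- of_real (c j), 1 :: complex:]) = n"
    by (subst degree_prod_eq_sum_degree) auto
  have poly_q: "poly q z = coeff p n * (\<Prod>j<n. z - of_real (c j))" for z
    by (simp add: q_def poly_prod)
  have inj: "inj_on (\<lambda>j. complex_of_real (c j)) {..<n}"
  proof (rule inj_onI)
    fix i j assume ij: "i \<in> {..<n}" "j \<in> {..<n}" "complex_of_real (c i) = of_real (c j)"
    then have "2 * real i < 2 * real j + 1" "2 * real j < 2 * real i + 1"
      using c(1)[of i] c(1)[of j] by auto
    then show "i = j" by linarith
  qed
  have "p = q"
  proof (rule poly_eqI_degree_lead_coeff[where n = n])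
    show "card ((\<lambda>j. complex_of_real (c j)) ` {..<n}) \<ge> n"
      using card_image[OF inj] by simp
    show "degree p \<le> n" by fact
    show "degree q \<le> n" using deg by (simp add: q_def)
    show "coeff p n = coeff q n" using monic deg by (simp add: q_def)
    fix z assume "z \<in> (\<lambda>j. complex_of_real (c j)) ` {..<n}"
    then show "poly p z = poly q z"
      using c(2) by (auto simp: poly_q)
  qed
  define l where "l = a n"
  have l: "coeff p n = of_real l" by (simp add: coeff_p l_def)
  have "l \<noteq> 0" using \<open>p = q\<close> \<open>p \<noteq> 0\<close> l by (auto simp: q_def)
  define C where "C z = (B z - B 0) / of_real l" for z
  show ?thesis
  proof (rule that[of c C])
    show "2 * real j < c j \<and> c j < 2 * real j + 1" if "j < n" for j using c that by auto
    show "continuous_on closed_half C"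
      unfolding C_def using \<open>l \<noteq> 0\<close> by (intro continuous_intros contB) auto
    show "C 0 = 0" by (simp add: C_def)
    show "(C has_field_derivative (\<Prod>j<n. z - of_real (c j)) / root_prod n z) (at z within closed_half)"
      if "z \<in> closed_half - of_nat ` {..<2 * n}" for z
    proof -
      have "(C has_field_derivative (poly p z / root_prod n z - 0) / of_real l) (at z within closed_half)"
        unfolding C_def by (intro DERIV_cdivide DERIV_diff B' that DERIV_const)
      then show ?thesis using \<open>l \<noteq> 0\<close> \<open>p = q\<close> l by (simp add: poly_q)
    qed
    show "Im (C (of_nat (2 * j + 1))) = Im (C (of_nat (2 * j)))" if "j < n" for j
      using ImB[OF that] by (simp add: C_def)
  qed
qed

subsection \<open>Positivity and normalization of the derivative\<close>

text \<open>A slit contributes twice the value at \<open>c j\<close> minus the values at its two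
  ends, which by monotonicity is at most the increase of \<open>\<theta>\<close> over that slit in
  absolute value. The slits are disjoint, so these increases add up to at most the total
  one.\<close>

lemma interlacing_sum_bound:
  fixes \<theta> :: "real \<Rightarrow> real"
  assumes "mono \<theta>" "\<And>j. j < n \<Longrightarrow> 2 * real j < c j \<and> c j < 2 * real j + 1"
  shows "\<bar>2 * (\<Sum>j<n. \<theta> (c j)) - (\<Sum>k<2 * n. \<theta> (real k))\<bar> \<le> \<theta> (2 * real n) - \<theta> 0"
  using assms(2)
proof (induction n)
  case (Suc n)
  have "\<theta> (2 * real n) \<le> \<theta> (c n)" "\<theta> (c n) \<le> \<theta> (2 * real n + 1)"
    "\<theta> (2 * real n + 1) \<le> \<theta> (2 * real (Suc n))"
    using Suc.prems[of n] by (auto intro!: monoD[OF \<open>mono \<theta>\<close>])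
  moreover have "\<bar>2 * (\<Sum>j<n. \<theta> (c j)) - (\<Sum>k<2 * n. \<theta> (real k))\<bar> \<le> \<theta> (2 * real n) - \<theta> 0"
    by (rule Suc.IH) (use Suc.prems less_SucI in blast)
  moreover have "(\<Sum>k<2 * Suc n. \<theta> (real k)) = (\<Sum>k<2 * n. \<theta> (real k)) + \<theta> (2 * real n) + \<theta> (2 * real n + 1)"
    by (simp add: add.commute)
  moreover have "(\<Sum>j<Suc n. \<theta> (c j)) = (\<Sum>j<n. \<theta> (c j)) + \<theta> (c n)" by simp
  ultimately show ?case by linarith
qed simp

locale slit_weights =
  fixes n :: nat and c :: "nat \<Rightarrow> real"
  assumes n: "n \<ge> 1"
    and c: "j < n \<Longrightarrow> 2 * real j < c j \<and> c j < 2 * real j + 1"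
begin

definition G :: "complex \<Rightarrow> complex" where
  "G z = (\<Prod>j<n. z - of_real (c j)) / root_prod n z"

text \<open>
  The argument of \<open>G z\<close> is half of an alternating sum of increments of the angle \<open>arg (z - e)\<close>, which
  increases with \<open>e\<close> from more than \<open>0\<close> to less than \<open>\<pi>\<close>.
\<close>

lemma Re_G_pos_open_half:
  assumes "Im z > 0"
  shows "Re (G z) > 0"
proof -
  define w where "w = (\<Sum>j<n. ulog (z - of_real (c j))) - (\<Sum>k<2 * n. ulog (z - of_nat k)) / 2"
  have "(\<Prod>j<n. z - of_real (c j)) = (\<Prod>j<n. exp (ulog (z - of_real (c j))))"
    using assms by (intro prod.cong refl exp_ulog[symmetric]) (auto simp: complex_eq_iff)
  then have "G z = exp w"
    by (simp add: G_def root_prod_def w_def exp_diff exp_sum)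
  define \<theta> where "\<theta> e = pi / 2 - arctan ((Re z - e) / Im z)" for e
  have "mono \<theta>"
    using assms by (auto simp: mono_def \<theta>_def intro!: arctan_monotone' divide_right_mono)
  have *: "Im (ulog (z - of_real e)) = \<theta> e" for e
    using Im_ulog[of "z - of_real e"] assms by (simp add: \<theta>_def)
  have **: "Im (ulog (z - of_nat k)) = \<theta> (real k)" for k
    using *[of "real k"] by simp
  have "2 * Im w = 2 * (\<Sum>j<n. \<theta> (c j)) - (\<Sum>k<2 * n. \<theta> (real k))"
    by (simp add: w_def Im_sum * **)
  then have "\<bar>2 * Im w\<bar> \<le> \<theta> (2 * real n) - \<theta> 0"
    using interlacing_sum_bound[OF \<open>mono \<theta>\<close> c, of n] by simp
  also have "\<dots> < pi"
    using arctan_lbound[of "(Re z - 2 * real n) / Im z"] arctan_ubound[of "Re z / Im z"]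
    by (simp add: \<theta>_def)
  finally have "cos (Im w) > 0"
    by (intro cos_gt_zero_pi) auto
  with \<open>G z = exp w\<close> show ?thesis by (simp add: Re_exp)
qed

lemma holomorphic_on_G: "G holomorphic_on root_domain n"
  unfolding G_def by (intro holomorphic_intros holomorphic_on_root_prod) auto

lemma closed_half_minus_slits_subset: "closed_half - slits n \<subseteq> root_domain n"
  using closed_half_Int_root_domain[of n] not_slit_not_integer by blast

lemma continuous_G:
  assumes "z \<in> closed_half - slits n"
  shows "isCont G z"
  using holomorphic_on_imp_continuous_on[OF holomorphic_on_G] open_root_domain assms
    closed_half_minus_slits_subset by (auto simp: continuous_on_eq_continuous_at)

lemma prod_c_nonzero:
  assumes "z \<notin> slits n"
  shows "(\<Prod>j<n. z - of_real (c j)) \<noteq> 0"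
proof -
  have "z \<noteq> of_real (c j)" if "j < n" for j
  proof
    assume "z = of_real (c j)"
    then have "z \<in> slits n"
      using c[OF that] that by (auto simp: slits_def intro!: exI[of _ j])
    with assms show False by simp
  qed
  then show ?thesis by simp
qed

lemma Im_G_gap:
  assumes "z \<notin> slits n" "Im z = 0"
  shows "Im (G z) = 0"
proof -
  have z: "z = Complex (Re z) 0" using assms by (simp add: complex_eq_iff)
  have "Im (root_prod n z) = 0" using root_prod_gap[of "Re z" n] assms z by metis
  moreover have "(\<Prod>j<n. z - of_real (c j)) = of_real (\<Prod>j<n. Re z - c j)"
    by (subst z) (simp add: complex_of_real_def[symmetric])
  ultimately show ?thesis
    by (simp add: G_def Im_divide del: of_real_prod)
qed

text \<open>On a gap, approximation from above gives only a nonnegative real part; it is positive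
  because \<open>G\<close> is real and nonzero there.\<close>

lemma Re_G_pos:
  assumes "z \<in> closed_half - slits n"
  shows "Re (G z) > 0"
proof (cases "Im z > 0")
  case True
  then show ?thesis by (rule Re_G_pos_open_half)
next
  case False
  then have "Im z = 0" using assms by simp
  have "(\<lambda>m. z + of_real (inverse (real (Suc m))) * \<i>) \<longlonglongrightarrow> z + of_real 0 * \<i>"
    by (intro tendsto_intros LIMSEQ_inverse_real_of_nat)
  then have "(\<lambda>m. z + of_real (inverse (real (Suc m))) * \<i>) \<longlonglongrightarrow> z"
    by simp
  then have "(\<lambda>m. Re (G (z + of_real (inverse (real (Suc m))) * \<i>))) \<longlonglongrightarrow> Re (G z)"
    by (intro tendsto_Re isCont_tendsto_compose[OF continuous_G[OF assms]])
  then have "Re (G z) \<ge> 0"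
    by (rule LIMSEQ_le_const)
       (use \<open>Im z = 0\<close> in \<open>auto intro!: less_imp_le[OF Re_G_pos_open_half] simp del: of_nat_Suc\<close>)
  moreover have "G z \<noteq> 0"
    using prod_c_nonzero[of z] assms by (simp add: G_def)
  ultimately show ?thesis
    using Im_G_gap[of z] assms \<open>Im z = 0\<close> by (auto simp: complex_eq_iff)
qed

text \<open>A real numerator is divided by an imaginary root.\<close>

lemma Re_G_slit:
  assumes "j < n" "2 * real j < t" "t < 2 * real j + 1"
  shows "Re (G (Complex t 0)) = 0"
proof -
  have "(\<Prod>j<n. Complex t 0 - of_real (c j)) = of_real (\<Prod>j<n. t - c j)"
    by (simp add: complex_of_real_def[symmetric])
  then show ?thesis
    using root_prod_slit[OF assms] by (simp add: G_def Re_divide del: of_real_prod)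
qed

text \<open>The square of \<open>G\<close> is a product of quotients tending to 1, and the positive
  real part of \<open>G\<close> selects the principal square root. The filter is left general to
  cover both ends of the line.\<close>

lemma G_tendsto_1:
  assumes "filterlim (\<lambda>s. s) at_infinity F" "y \<ge> 0"
  shows "((\<lambda>s. G (Complex s y)) \<longlongrightarrow> 1) F"
proof -
  have inf: "filterlim (\<lambda>s. Complex s y - a) at_infinity F" for a
  proof -
    have "filterlim (\<lambda>s. of_real s :: complex) at_infinity F"
      using assms(1) unfolding filterlim_at_infinity_conv_norm_at_top by simp
    then have "filterlim (\<lambda>s. of_real s + (Complex 0 y - a)) at_infinity F"
      by (intro tendsto_add_filterlim_at_infinity') auto
    moreover have "(\<lambda>s. Complex s y - a) = (\<lambda>s. of_real s + (Complex 0 y - a))"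
      by (simp add: fun_eq_iff complex_eq_iff)
    ultimately show ?thesis by metis
  qed
  have 1: "((\<lambda>s. (Complex s y - a) / (Complex s y - b)) \<longlongrightarrow> 1) F" for a b
  proof -
    have "((\<lambda>s. 1 + (b - a) * inverse (Complex s y - b)) \<longlongrightarrow> 1 + (b - a) * 0) F"
      by (intro tendsto_intros filterlim_compose[OF tendsto_inverse_0 inf])
    moreover have "\<forall>\<^sub>F s in F. 1 + (b - a) * inverse (Complex s y - b) = (Complex s y - a) / (Complex s y - b)"
      using filterlim_at_infinity_imp_eventually_ne[OF inf, of 0 b]
      by eventually_elim (simp add: field_simps)
    ultimately show ?thesis
      by (simp add: tendsto_cong)
  qed
  have off: "\<forall>\<^sub>F s in F. Complex s y \<notin> slits n"
  proof -
    have "\<forall>\<^sub>F s in F. norm s \<ge> 2 * real n + 1"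
      using assms(1) unfolding filterlim_at_infinity_conv_norm_at_top filterlim_at_top by blast
    then show ?thesis
      by eventually_elim (auto simp: slits_def)
  qed
  \<comment> \<open>Each zero occurs twice in the square and is matched with both ends of its
    slit.\<close>
  have "((\<lambda>s. \<Prod>j<n. ((Complex s y - of_real (c j)) / (Complex s y - of_nat (2 * j)))
      * ((Complex s y - of_real (c j)) / (Complex s y - of_nat (2 * j + 1)))) \<longlongrightarrow> (\<Prod>j<n. 1 * 1)) F"
    by (intro tendsto_prod tendsto_mult 1)
  moreover have "\<forall>\<^sub>F s in F. (\<Prod>j<n. ((Complex s y - of_real (c j)) / (Complex s y - of_nat (2 * j)))
      * ((Complex s y - of_real (c j)) / (Complex s y - of_nat (2 * j + 1)))) = (G (Complex s y))\<^sup>2"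
    using off
  proof eventually_elim
    case (elim s)
    show ?case
      unfolding G_def power_divide root_prod_square[OF not_slit_not_integer[OF elim]] prod_pairs
      by (simp only: power2_eq_square prod.distrib[symmetric] prod_dividef[symmetric] times_divide_times_eq)
  qed
  ultimately have "((\<lambda>s. (G (Complex s y))\<^sup>2) \<longlongrightarrow> 1) F"
    by (simp add: tendsto_cong)
  then have "((\<lambda>s. csqrt ((G (Complex s y))\<^sup>2)) \<longlongrightarrow> csqrt 1) F"
    by (rule isCont_tendsto_compose[rotated]) (simp add: continuous_at_csqrt)
  moreover have "\<forall>\<^sub>F s in F. csqrt ((G (Complex s y))\<^sup>2) = G (Complex s y)"
    using off by eventually_elim (use Re_G_pos \<open>y \<ge> 0\<close> in \<open>auto intro!: csqrt_square\<close>)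
  ultimately show ?thesis
    by (simp add: tendsto_cong)
qed

end

subsection \<open>Boundary values of the slit map\<close>

text \<open>The boundary values run along the real axis on the gaps and go up and down a vertical
  tooth on each slit; \<open>Im_A_slit\<close> says that every tooth closes up.\<close>

locale comb_map = slit_weights +
  fixes A :: "complex \<Rightarrow> complex"
  assumes continuous_A: "continuous_on closed_half A"
    and A_0: "A 0 = 0"
    and A_deriv: "z \<in> closed_half - of_nat ` {..<2 * n} \<Longrightarrow>
      (A has_field_derivative G z) (at z within closed_half)"
    and Im_A_slit: "j < n \<Longrightarrow> Im (A (of_nat (2 * j + 1))) = Im (A (of_nat (2 * j)))"
begin

lemma A_deriv': "z \<in> closed_half - slits n \<Longrightarrow> (A has_field_derivative G z) (at z within closed_half)"
  using A_deriv not_slit_not_integer by blast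

lemma continuous_on_line: "y \<ge> 0 \<Longrightarrow> continuous_on S (\<lambda>t. A (Complex t y))"
  by (rule continuous_on_compose2[OF continuous_A]) (auto intro!: continuous_intros)

text \<open>\<open>G\<close> is real on gaps. Only the interior of the interval has to avoid the
  slits, so an end point may be a branch point, where continuity of \<open>A\<close>
  suffices.\<close>

lemma Im_A_constant:
  assumes "a \<le> b" "\<And>t. a < t \<Longrightarrow> t < b \<Longrightarrow> Complex t 0 \<notin> slits n"
  shows "Im (A (Complex b 0)) = Im (A (Complex a 0))"
proof (cases "a = b")
  case False
  show ?thesis
  proof (rule DERIV_isconst_end[of a b "\<lambda>t. Im (A (Complex t 0))"])
    fix t assume "a < t" "t < b"
    then show "((\<lambda>t. Im (A (Complex t 0))) has_real_derivative 0) (at t)"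
      using assms horizontal_deriv(2)[OF A_deriv'[of "Complex t 0"]] Im_G_gap[of "Complex t 0"] by simp
  qed (use assms False in \<open>auto intro!: continuous_intros continuous_on_line\<close>)
qed simp

lemma of_nat_eq_Complex: "of_nat m = Complex (real m) 0"
  by (simp add: complex_eq_iff)

lemma open_gap_not_slit:
  assumes "2 * real j + 1 < t" "t < 2 * real j + 2"
  shows "Complex t 0 \<notin> slits m"
proof
  assume "Complex t 0 \<in> slits m"
  then obtain i where "2 * real i \<le> t" "t \<le> 2 * real i + 1" by (auto simp: slits_def)
  with assms have "2 * real j < 2 * real i + 1" "2 * real i < 2 * real j + 2" by linarith+
  then have "i = j" by linarith
  with assms \<open>t \<le> 2 * real i + 1\<close> show False by simp
qed

text \<open>Walking right from 0, a slit restores the imaginary part by the closing condition and a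
  gap does not change it.\<close>

lemma Im_A_even: "j < n \<Longrightarrow> Im (A (Complex (2 * real j) 0)) = 0"
proof (induction j)
  case 0
  then show ?case using A_0 by (simp add: flip: zero_complex.code)
next
  case (Suc j)
  have "Im (A (Complex (2 * real (Suc j)) 0)) = Im (A (Complex (2 * real j + 1) 0))"
    by (rule Im_A_constant) (use open_gap_not_slit in auto)
  also have "\<dots> = Im (A (Complex (2 * real j) 0))"
    using Im_A_slit[of j] Suc.prems by (simp add: of_nat_eq_Complex add.commute)
  also have "\<dots> = 0" using Suc by simp
  finally show ?case .
qed

lemma Im_A_gap:
  assumes "z \<notin> slits n" "Im z = 0"
  shows "Im (A z) = 0"
proof -
  define t where "t = Re z"
  have z: "z = Complex t 0" using assms by (simp add: t_def complex_eq_iff)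
  have off: "t < 2 * real j \<or> 2 * real j + 1 < t" if "j < n" for j
    using assms that by (auto simp: z slits_def not_le)
  show ?thesis
  proof (cases "t < 0")
    case True
    have "Im (A (Complex 0 0)) = Im (A (Complex t 0))"
      by (rule Im_A_constant) (use True in \<open>auto simp: slits_def\<close>)
    then show ?thesis using A_0 by (simp add: z flip: zero_complex.code)
  next
    case False
    \<comment> \<open>The maximum of \<open>J\<close> is the last slit to the left of
      \<open>t\<close>; between its right end and \<open>t\<close> there is only a gap.\<close>
    define J where "J = {j. j < n \<and> 2 * real j + 1 \<le> t}"
    have "0 \<in> J" using off[of 0] False n by (auto simp: J_def)
    have "finite J" by (simp add: J_def)
    define j where "j = Max J"
    have "j \<in> J" and max: "\<And>i. i \<in> J \<Longrightarrow> i \<le> j"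
      using \<open>finite J\<close> \<open>0 \<in> J\<close> Max_in unfolding j_def by (auto intro: Max_ge)
    then have j: "j < n" "2 * real j + 1 \<le> t" by (auto simp: J_def)
    have "Im (A (Complex t 0)) = Im (A (Complex (2 * real j + 1) 0))"
    proof (rule Im_A_constant[OF j(2)], rule notI)
      fix s assume s: "2 * real j + 1 < s" "s < t" "Complex s 0 \<in> slits n"
      then obtain i where i: "i < n" "2 * real i \<le> s" "s \<le> 2 * real i + 1"
        by (auto simp: slits_def)
      then have "i \<in> J" using off[of i] s by (auto simp: J_def)
      from max[OF this] i s show False by linarith
    qed
    also have "\<dots> = Im (A (Complex (2 * real j) 0))"
      using Im_A_slit[OF j(1)] by (simp add: of_nat_eq_Complex add.commute)
    finally show ?thesis using Im_A_even[OF j(1)] by (simp add: z)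
  qed
qed

text \<open>The abscissa of the \<open>j\<close>-th singular point. The left end of the slit stands
  for the whole slit, by \<open>Re_A_slit\<close>.\<close>

definition site :: "nat \<Rightarrow> real" where
  "site j = Re (A (Complex (2 * real j) 0))"

lemma Re_A_slit:
  assumes "j < n" "2 * real j \<le> t" "t \<le> 2 * real j + 1"
  shows "Re (A (Complex t 0)) = site j"
  unfolding site_def
proof (rule DERIV_isconst2[of "2 * real j" "2 * real j + 1" "\<lambda>t. Re (A (Complex t 0))"])
  fix t assume t: "2 * real j < t" "t < 2 * real j + 1"
  have "((\<lambda>t. Re (A (Complex t 0))) has_real_derivative Re (G (Complex t 0))) (at t)"
    by (rule horizontal_deriv[OF A_deriv]) (use open_slit_not_integer[OF t] in auto)
  then show "((\<lambda>t. Re (A (Complex t 0))) has_real_derivative 0) (at t)"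
    using Re_G_slit[OF assms(1) t] by simp
qed (use assms in \<open>auto intro!: continuous_intros continuous_on_line\<close>)

lemma Re_A_deriv:
  assumes "Complex t y \<notin> slits n" "y \<ge> 0"
  shows "((\<lambda>t. Re (A (Complex t y))) has_real_derivative Re (G (Complex t y))) (at t)"
  using assms by (intro horizontal_deriv A_deriv') auto

text \<open>Above the axis the derivative is positive. The axis itself meets slits and branch
  points, so there the inequality is obtained as a limit from above.\<close>

lemma mono_Re_A:
  assumes "y \<ge> 0"
  shows "mono (\<lambda>t. Re (A (Complex t y)))"
proof
  have pos: "Re (A (Complex s y)) \<le> Re (A (Complex t y))" if "s \<le> t" "y > 0" for s t y
    using that Re_A_deriv[of _ y] Re_G_pos_open_half[of "Complex _ y"]
    by (intro DERIV_nonneg_imp_nondecreasing[of s t "\<lambda>t. Re (A (Complex t y))"] exI conjI)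
       (auto simp: slits_def intro: less_imp_le)
  have lim: "(\<lambda>m. Re (A (Complex t (y + inverse (real (Suc m)))))) \<longlonglongrightarrow> Re (A (Complex t y))" for t
  proof (intro tendsto_Re continuous_on_tendsto_compose[OF continuous_A])
    have "(\<lambda>m. Complex t (y + inverse (real (Suc m)))) \<longlonglongrightarrow> Complex t (y + 0)"
      by (intro tendsto_intros LIMSEQ_inverse_real_of_nat)
    then show "(\<lambda>m. Complex t (y + inverse (real (Suc m)))) \<longlonglongrightarrow> Complex t y" by simp
  qed (use assms in auto)
  fix s t :: real assume "s \<le> t"
  show "Re (A (Complex s y)) \<le> Re (A (Complex t y))"
    by (rule LIMSEQ_le[OF lim lim], intro exI[of _ 0] allI impI pos[OF \<open>s \<le> t\<close>] add_nonneg_pos assms)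
       (simp del: of_nat_Suc)
qed

text \<open>A monotone function takes its value at a point of positive derivative only once. The
  point \<open>s\<close> may lie on a slit, which later shows that the sites are not attained off
  the slits.\<close>

lemma Re_A_inj:
  assumes "Complex t y \<notin> slits n" "y \<ge> 0" "Re (A (Complex s y)) = Re (A (Complex t y))"
  shows "s = t"
proof (rule ccontr)
  assume "s \<noteq> t"
  define f where "f = (\<lambda>t. Re (A (Complex t y)))"
  have "mono f" unfolding f_def by (rule mono_Re_A) fact
  have f': "(f has_real_derivative Re (G (Complex t y))) (at t)"
    unfolding f_def using assms by (intro Re_A_deriv) auto
  have pos: "Re (G (Complex t y)) > 0"
    using assms by (intro Re_G_pos) auto
  obtain d where d: "d > 0" "\<And>h. h > 0 \<Longrightarrow> h < d \<Longrightarrow> f (t - h) < f t"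
    using DERIV_pos_inc_left[OF f' pos] by blast
  obtain e where e: "e > 0" "\<And>h. h > 0 \<Longrightarrow> h < e \<Longrightarrow> f t < f (t + h)"
    using DERIV_pos_inc_right[OF f' pos] by blast
  define h where "h = min (min d e) \<bar>s - t\<bar> / 2"
  have h: "h > 0" "h < d" "h < e" "h \<le> \<bar>s - t\<bar>"
    using d e \<open>s \<noteq> t\<close> by (auto simp: h_def min_def)
  have "f s \<le> f (t - h) \<or> f (t + h) \<le> f s"
    using h monoD[OF \<open>mono f\<close>, of s "t - h"] monoD[OF \<open>mono f\<close>, of "t + h" s] by linarith
  with d(2)[OF h(1,2)] e(2)[OF h(1,3)] assms(3) show False by (simp add: f_def)
qed

text \<open>By \<open>G_tendsto_1\<close> the slope is at least 1/2 far out on both sides, so the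
  function is unbounded in both directions and the intermediate value theorem applies.\<close>

lemma Re_A_surj:
  assumes "y \<ge> 0"
  shows "\<exists>t. Re (A (Complex t y)) = x"
proof -
  define f where "f = (\<lambda>t. Re (A (Complex t y)))"
  have ev: "\<forall>\<^sub>F t in F. (\<exists>d. (f has_real_derivative d) (at t) \<and> d \<ge> 1 / 2)"
    if F: "filterlim (\<lambda>t. t) at_infinity F" for F
  proof -
    have "((\<lambda>t. Re (G (Complex t y))) \<longlongrightarrow> Re 1) F"
      by (intro tendsto_Re G_tendsto_1 F assms)
    then have "\<forall>\<^sub>F t in F. Re (G (Complex t y)) > 1 / 2"
      by (rule order_tendstoD) simp
    moreover have "\<forall>\<^sub>F t in F. norm t \<ge> 2 * real n + 1"
      using F unfolding filterlim_at_infinity_conv_norm_at_top filterlim_at_top by blast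
    ultimately show ?thesis
    proof eventually_elim
      case (elim t)
      then have "Complex t y \<notin> slits n" by (auto simp: slits_def)
      from Re_A_deriv[OF this assms] elim show ?case
        unfolding f_def by (intro exI[of _ "Re (G (Complex t y))"]) auto
    qed
  qed
  have slope: "f a - a / 2 \<le> f b - b / 2"
    if "a \<le> b" and steep: "\<And>t. a \<le> t \<Longrightarrow> t \<le> b \<Longrightarrow> \<exists>d. (f has_real_derivative d) (at t) \<and> d \<ge> 1 / 2" for a b
  proof (rule DERIV_nonneg_imp_nondecreasing[OF \<open>a \<le> b\<close>, of "\<lambda>t. f t - t / 2"])
    fix t assume "a \<le> t" "t \<le> b"
    then obtain d where "(f has_real_derivative d) (at t)" "d \<ge> 1 / 2" using steep by blast
    then show "\<exists>d. ((\<lambda>t. f t - t / 2) has_real_derivative d) (at t) \<and> d \<ge> 0"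
      by (intro exI[of _ "d - 1 / 2"]) (auto intro!: derivative_eq_intros)
  qed
  obtain M where M: "\<And>t. t \<ge> M \<Longrightarrow> \<exists>d. (f has_real_derivative d) (at t) \<and> d \<ge> 1 / 2"
    using ev[OF filterlim_mono[OF filterlim_ident order_refl at_top_le_at_infinity, simplified]]
    unfolding eventually_at_top_linorder by blast
  obtain L where L: "\<And>t. t \<le> L \<Longrightarrow> \<exists>d. (f has_real_derivative d) (at t) \<and> d \<ge> 1 / 2"
    using ev[OF filterlim_mono[OF filterlim_ident order_refl at_bot_le_at_infinity, simplified]]
    unfolding eventually_at_bot_linorder by blast
  \<comment> \<open>At slope 1/2, twice the missing height is a sufficient horizontal
    distance.\<close>
  define b where "b = max M (2 * \<bar>x - f M\<bar> + M)"
  define a where "a = min L (L - 2 * \<bar>x - f L\<bar>)"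
  have "f M - M / 2 \<le> f b - b / 2" by (rule slope[OF _ M]) (auto simp: b_def)
  moreover have "2 * \<bar>x - f M\<bar> + M \<le> b" by (simp add: b_def)
  ultimately have "x \<le> f b" using abs_ge_self[of "x - f M"] by argo
  have "f a - a / 2 \<le> f L - L / 2" by (rule slope[OF _ L]) (auto simp: a_def)
  moreover have "a \<le> L - 2 * \<bar>x - f L\<bar>" by (simp add: a_def)
  ultimately have "f a \<le> x" using abs_ge_minus_self[of "x - f L"] by argo
  have "continuous_on S f" for S
    unfolding f_def using assms by (intro continuous_intros continuous_on_line)
  \<comment> \<open>The order of \<open>a\<close> and \<open>b\<close> is not known, hence the two
    forms of the intermediate value theorem.\<close>
  with \<open>x \<le> f b\<close> \<open>f a \<le> x\<close> have "\<exists>t. f t = x"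
    using IVT'[of f a x b] IVT2'[of f a x b] by (cases "a \<le> b") auto
  then show ?thesis by (simp add: f_def)
qed

end

subsection \<open>Reflection in the real axis\<close>

definition reflect :: "(complex \<Rightarrow> complex) \<Rightarrow> complex \<Rightarrow> complex" where
  "reflect f z = (if Im z \<ge> 0 then f z else cnj (f (cnj z)))"

definition fold_up :: "complex \<Rightarrow> complex" where
  "fold_up z = Complex (Re z) \<bar>Im z\<bar>"

lemma fold_up_upper: "Im z \<ge> 0 \<Longrightarrow> fold_up z = z"
  by (simp add: fold_up_def complex_eq_iff)

lemma fold_up_lower: "Im z \<le> 0 \<Longrightarrow> fold_up z = cnj z"
  by (simp add: fold_up_def complex_eq_iff)

lemma Re_reflect: "Re (reflect f z) = Re (f (fold_up z))"
  by (simp add: reflect_def fold_up_upper fold_up_lower)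

text \<open>Schwarz reflection. At a point of the axis, real value and real derivative make the
  limits of the difference quotient from above and from below agree.\<close>

lemma reflect_deriv:
  assumes f: "(f has_field_derivative d) (at (fold_up z) within closed_half)"
    and real: "Im z = 0 \<Longrightarrow> Im (f z) = 0 \<and> Im d = 0"
  shows "(reflect f has_field_derivative (if Im z \<ge> 0 then d else cnj d)) (at z)"
proof -
  have lower: "((\<lambda>w. cnj (f (cnj w))) has_field_derivative cnj d) (at z within S)"
    if "Im z \<le> 0" "S \<subseteq> {w. Im w \<le> 0}" for S
  proof -
    have "(f has_field_derivative d) (at (cnj z) within cnj ` S)"
      by (rule DERIV_subset[OF f[unfolded fold_up_lower[OF that(1)]]]) (use that(2) in auto)
    then have "((\<lambda>w. f (cnj w)) has_derivative (\<lambda>h. d * cnj h)) (at z within S)"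
      unfolding has_field_derivative_def
      by (rule has_derivative_in_compose[OF bounded_linear.has_derivative[OF bounded_linear_cnj has_derivative_ident]])
    from bounded_linear.has_derivative[OF bounded_linear_cnj this] show ?thesis
      by (simp add: has_field_derivative_def)
  qed
  consider "Im z > 0" | "Im z < 0" | "Im z = 0" by linarith
  then show ?thesis
  proof cases
    case 1
    then have "(f has_field_derivative d) (at z within open_half)"
      by (intro DERIV_subset[OF f[unfolded fold_up_upper[OF less_imp_le[OF 1]]]]) auto
    then have "(f has_field_derivative d) (at z)"
      using at_within_open[OF _ open_halfspace_Im_gt[of 0], of z] 1 by simp
    then have "(reflect f has_field_derivative d) (at z)"
      by (rule has_field_derivative_transform_within_open[OF _ open_halfspace_Im_gt[of 0]])
         (use 1 in \<open>auto simp: reflect_def\<close>)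
    then show ?thesis using 1 by simp
  next
    case 2
    then have "((\<lambda>w. cnj (f (cnj w))) has_field_derivative cnj d) (at z)"
      using lower[of "{w. Im w < 0}"] at_within_open[OF _ open_halfspace_Im_lt[of 0], of z] by force
    then have "(reflect f has_field_derivative cnj d) (at z)"
      by (rule has_field_derivative_transform_within_open[OF _ open_halfspace_Im_lt[of 0]])
         (use 2 in \<open>auto simp: reflect_def\<close>)
    then show ?thesis using 2 by simp
  next
    case 3
    have z: "cnj z = z" "cnj (f z) = f z" "cnj d = d" "fold_up z = z"
      using 3 real by (auto simp: complex_eq_iff fold_up_def)
    have "(reflect f has_field_derivative d) (at z within closed_half)"
      by (rule has_field_derivative_transform_within[OF f[unfolded z] zero_less_one])
         (use 3 in \<open>auto simp: reflect_def\<close>)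
    moreover have "(reflect f has_field_derivative d) (at z within insert z {w. Im w < 0})"
    proof (rule has_field_derivative_transform_within[OF _ zero_less_one])
      show "((\<lambda>w. cnj (f (cnj w))) has_field_derivative d) (at z within insert z {w. Im w < 0})"
        using lower[of "insert z {w. Im w < 0}"] 3 z by fastforce
    qed (use 3 z in \<open>auto simp: reflect_def\<close>)
    moreover have "closed_half \<union> insert z {w. Im w < 0} = UNIV" by auto
    ultimately have "(reflect f has_field_derivative d) (at z)"
      unfolding has_field_derivative_iff by (rule Lim_Un_univ)
    then show ?thesis using 3 by simp
  qed
qed

text \<open>
  Unlike in \<open>reflect_deriv\<close>, \<open>f\<close> need not be real on the axis: \<open>reflect f\<close> may jump there, but only in
  its imaginary part.
\<close>

lemma Re_reflect_deriv:
  assumes f: "(f has_field_derivative d) (at (fold_up z) within closed_half)"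
    and real: "Im z = 0 \<Longrightarrow> Im d = 0"
  shows "((\<lambda>w. Re (reflect f w)) has_derivative (\<lambda>h. Re ((if Im z \<ge> 0 then d else cnj d) * h))) (at z)"
proof -
  \<comment> \<open>Subtracting an imaginary constant makes the value at \<open>z\<close> real when
    \<open>z\<close> is on the axis, and does not affect the real part of the reflection.\<close>
  define f0 where "f0 w = f w - \<i> * of_real (Im (f z))" for w
  have "(f0 has_field_derivative d - 0) (at (fold_up z) within closed_half)"
    unfolding f0_def by (intro DERIV_diff f DERIV_const)
  then have "(reflect f0 has_field_derivative (if Im z \<ge> 0 then d else cnj d)) (at z)"
    by (intro reflect_deriv) (auto simp: f0_def real)
  then have "((\<lambda>w. Re (reflect f0 w)) has_derivative (\<lambda>h. Re ((if Im z \<ge> 0 then d else cnj d) * h))) (at z)"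
    unfolding has_field_derivative_def by (rule bounded_linear.has_derivative[OF bounded_linear_Re])
  moreover have "Re (reflect f0 w) = Re (reflect f w)" for w
    by (simp add: Re_reflect f0_def)
  ultimately show ?thesis by simp
qed

subsection \<open>The solution in the punctured plane\<close>

lemma C1_on_has_derivative:
  assumes V: "open V"
    and f: "\<And>q. q \<in> V \<Longrightarrow> (f has_derivative (\<lambda>h. a q * fst h + b q * snd h)) (at q)"
    and ab: "continuous_on V a" "continuous_on V b"
  shows "C1_on f V" "q \<in> V \<Longrightarrow> partial_x f q = a q" "q \<in> V \<Longrightarrow> partial_y f q = b q"
proof -
  have x: "((\<lambda>t. f (t, y)) has_real_derivative a (x, y)) (at x)" if "(x, y) \<in> V" for x y
  proof -
    have "((\<lambda>t. (t, y)) has_derivative (\<lambda>h. (h, 0))) (at x)"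
      by (auto intro!: derivative_eq_intros)
    from has_derivative_compose[OF this f[OF that]] show ?thesis
      by (simp add: has_field_derivative_def)
  qed
  have y: "((\<lambda>t. f (x, t)) has_real_derivative b (x, y)) (at y)" if "(x, y) \<in> V" for x y
  proof -
    have "((\<lambda>t. (x, t)) has_derivative (\<lambda>h. (0, h))) (at y)"
      by (auto intro!: derivative_eq_intros)
    from has_derivative_compose[OF this f[OF that]] show ?thesis
      by (simp add: has_field_derivative_def)
  qed
  show px: "partial_x f q = a q" if "q \<in> V" for q
    using x[of "fst q" "snd q"] that by (auto simp: partial_x_def split: prod.split intro: DERIV_imp_deriv)
  show py: "partial_y f q = b q" if "q \<in> V" for q
    using y[of "fst q" "snd q"] that by (auto simp: partial_y_def split: prod.split intro: DERIV_imp_deriv)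
  have "continuous_on V (partial_x f)" "continuous_on V (partial_y f)"
    using ab px py by (simp_all cong: continuous_on_cong)
  then show "C1_on f V"
    unfolding C1_on_def using V by (auto simp: field_differentiable_def intro: x y)
qed

text \<open>Passes from total derivatives to the partial derivatives in the definition. The common
  \<open>s\<close> in the derivatives of \<open>g\<close> and \<open>k\<close> is the mixed second
  derivative.\<close>

lemma regular_solution_has_derivative:
  assumes V: "open V"
    and \<phi>: "\<And>q. q \<in> V \<Longrightarrow> (\<phi> has_derivative (\<lambda>h. g q * fst h + k q * snd h)) (at q)"
    and g: "\<And>q. q \<in> V \<Longrightarrow> (g has_derivative (\<lambda>h. r q * fst h + s q * snd h)) (at q)"
    and k: "\<And>q. q \<in> V \<Longrightarrow> (k has_derivative (\<lambda>h. s q * fst h + t q * snd h)) (at q)"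
    and cont: "continuous_on V r" "continuous_on V s" "continuous_on V t"
    and det: "\<And>q. q \<in> V \<Longrightarrow> r q * t q - (s q)\<^sup>2 = 1"
  shows "regular_solution \<phi> V"
proof -
  have "continuous_on V g" "continuous_on V k"
    by (intro continuous_at_imp_continuous_on ballI has_derivative_continuous[OF g]
        has_derivative_continuous[OF k]; assumption)+
  note \<phi>1 = C1_on_has_derivative[OF V \<phi> this]
  have gx: "(partial_x \<phi> has_derivative (\<lambda>h. r q * fst h + s q * snd h)) (at q)" if "q \<in> V" for q
    by (rule has_derivative_transform_within_open[OF g[OF that] V that]) (simp add: \<phi>1(2))
  have kx: "(partial_y \<phi> has_derivative (\<lambda>h. s q * fst h + t q * snd h)) (at q)" if "q \<in> V" for q
    by (rule has_derivative_transform_within_open[OF k[OF that] V that]) (simp add: \<phi>1(3))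
  note x = C1_on_has_derivative[OF V gx cont(1,2)]
  note y = C1_on_has_derivative[OF V kx cont(2,3)]
  show ?thesis
    unfolding regular_solution_def C2_on_def using \<phi>1(1) x(1) y(1) x(2,3) y(3) det by simp
qed

lemma regular_solution_subset:
  assumes "regular_solution \<phi> V" "open W" "W \<subseteq> V"
  shows "regular_solution \<phi> W"
  using assms unfolding regular_solution_def C2_on_def C1_on_def
  by (auto elim: continuous_on_subset)

lemma closed_slits: "closed (slits n)"
proof -
  have "slits n = (\<Union>j<n. {z. Im z = 0} \<inter> {z. Re z \<ge> 2 * real j} \<inter> {z. Re z \<le> 2 * real j + 1})"
    by (auto simp: slits_def)
  moreover have "closed {z. Im z = 0}"
    by (intro closed_Collect_eq continuous_intros)
  ultimately show ?thesis
    by (simp add: closed_UN closed_Int closed_halfspace_Re_le closed_halfspace_Re_ge)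
qed

lemma fold_up_slits: "fold_up z \<in> slits n \<longleftrightarrow> z \<in> slits n"
  by (simp add: slits_def fold_up_def)

definition pt :: "real \<times> real \<Rightarrow> complex" where
  "pt v = Complex (fst v) (snd v)"

lemma pt_sel [simp]: "Re (pt v) = fst v" "Im (pt v) = snd v"
  by (simp_all add: pt_def)

lemma bounded_linear_pt: "bounded_linear pt"
  unfolding linear_conv_bounded_linear[symmetric]
  by (rule linearI) (simp_all add: complex_eq_iff)

section \<open>The slit map on the full slit plane, its inverse, and the solution\<close>

context comb_map
begin

definition A_ext :: "complex \<Rightarrow> complex" where
  "A_ext = reflect A"

definition G_ext :: "complex \<Rightarrow> complex" where
  "G_ext = reflect G"

lemma fold_up_gap: "z \<notin> slits n \<Longrightarrow> fold_up z \<in> closed_half - slits n"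
  by (auto simp: fold_up_slits) (simp add: fold_up_def)

lemma A_ext_deriv:
  assumes "z \<notin> slits n"
  shows "(A_ext has_field_derivative G_ext z) (at z)"
proof -
  have "(A_ext has_field_derivative (if Im z \<ge> 0 then G (fold_up z) else cnj (G (fold_up z)))) (at z)"
    unfolding A_ext_def
  proof (rule reflect_deriv)
    show "(A has_field_derivative G (fold_up z)) (at (fold_up z) within closed_half)"
      by (rule A_deriv'[OF fold_up_gap[OF assms]])
    show "Im (A z) = 0 \<and> Im (G (fold_up z)) = 0" if "Im z = 0"
      using that assms Im_A_gap Im_G_gap by (simp add: fold_up_upper)
  qed
  then show ?thesis
    by (simp add: G_ext_def reflect_def fold_up_upper fold_up_lower split: if_splits)
qed

lemma open_gaps: "open (- slits n)"
  using closed_slits by blast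

lemma holomorphic_on_A_ext: "A_ext holomorphic_on (- slits n)"
  using A_ext_deriv open_gaps by (auto simp: holomorphic_on_open)

lemma continuous_on_G_ext: "continuous_on (- slits n) G_ext"
proof -
  have "deriv A_ext holomorphic_on (- slits n)"
    by (rule holomorphic_deriv[OF holomorphic_on_A_ext open_gaps])
  then have "continuous_on (- slits n) (deriv A_ext)"
    by (rule holomorphic_on_imp_continuous_on)
  then show ?thesis
    by (rule continuous_on_eq) (simp add: DERIV_imp_deriv[OF A_ext_deriv])
qed

lemma Re_G_ext_pos: "z \<notin> slits n \<Longrightarrow> Re (G_ext z) > 0"
  unfolding G_ext_def Re_reflect by (intro Re_G_pos fold_up_gap)

lemma Re_A_ext: "Re (A_ext z) = Re (A (Complex (Re z) \<bar>Im z\<bar>))"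
  by (simp add: A_ext_def Re_reflect fold_up_def)

definition domain :: "(real \<times> real) set" where
  "domain = {v. pt v \<notin> slits n}"

definition sites :: "(real \<times> real) set" where
  "sites = (\<lambda>j. (site j, 0)) ` {..<n}"

text \<open>The change of variables from \<open>(\<phi>_x, y)\<close> to
  \<open>(x, y)\<close>.\<close>

definition F :: "real \<times> real \<Rightarrow> real \<times> real" where
  "F v = (Re (A_ext (pt v)), snd v)"

lemma open_domain: "open domain"
proof -
  have "domain = pt -` (- slits n)" by (auto simp: domain_def)
  then show ?thesis
    using open_gaps bounded_linear_pt by (auto intro!: open_vimage linear_continuous_on)
qed

lemma F_inj: "v \<in> domain \<Longrightarrow> F w = F v \<Longrightarrow> w = v"
proof -
  assume v: "v \<in> domain" and eq: "F w = F v"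
  have "fst w = fst v"
  proof (rule Re_A_inj)
    show "Complex (fst v) \<bar>snd v\<bar> \<notin> slits n"
      using v by (simp add: domain_def slits_def)
    show "Re (A (Complex (fst w) \<bar>snd v\<bar>)) = Re (A (Complex (fst v) \<bar>snd v\<bar>))"
      using eq by (auto simp: F_def Re_A_ext)
  qed simp
  with eq show "w = v" by (simp add: F_def prod_eq_iff)
qed

text \<open>A site is already the image of a slit end, so by \<open>F_inj\<close> no point of
  \<open>domain\<close> is mapped to it. Conversely every point has a preimage on its horizontal
  line, and a preimage on a slit would make the point a site.\<close>

lemma F_image: "F ` domain = - sites"
proof (intro equalityI subsetI)
  fix q assume "q \<in> F ` domain"
  then obtain v where v: "v \<in> domain" "q = F v" by blast
  show "q \<in> - sites"
  proof
    assume "q \<in> sites"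
    then obtain j where j: "j < n" "F v = (site j, 0)" using v by (auto simp: sites_def)
    then have "F (2 * real j, 0) = F v"
      by (auto simp: F_def Re_A_ext site_def)
    then have "v = (2 * real j, 0)" using F_inj v by metis
    with v j show False by (auto simp: domain_def slits_def)
  qed
next
  fix q assume q: "q \<in> - sites"
  obtain t where t: "Re (A (Complex t \<bar>snd q\<bar>)) = fst q"
    using Re_A_surj[of "\<bar>snd q\<bar>"] by auto
  have "(t, snd q) \<in> domain"
  proof (rule ccontr)
    assume "(t, snd q) \<notin> domain"
    then obtain j where "j < n" "2 * real j \<le> t" "t \<le> 2 * real j + 1" "snd q = 0"
      by (auto simp: domain_def slits_def)
    with t have j: "j < n" "q = (site j, 0)" by (auto simp: Re_A_slit prod_eq_iff)
    with q show False by (auto simp: sites_def)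
  qed
  moreover have "F (t, snd q) = q" using t by (simp add: F_def Re_A_ext prod_eq_iff)
  ultimately show "q \<in> F ` domain" by (metis imageI)
qed

definition \<Gamma> :: "real \<times> real \<Rightarrow> real \<times> real" where
  "\<Gamma> = inv_into domain F"

lemma \<Gamma>_F: "v \<in> domain \<Longrightarrow> \<Gamma> (F v) = v"
  unfolding \<Gamma>_def by (rule inv_into_f_f[OF inj_onI]) (metis F_inj)+

lemma \<Gamma>: "q \<notin> sites \<Longrightarrow> \<Gamma> q \<in> domain" "q \<notin> sites \<Longrightarrow> F (\<Gamma> q) = q"
  unfolding \<Gamma>_def using F_image inv_into_into[of q F domain] f_inv_into_f[of q F domain] by auto

lemma snd_\<Gamma>: "q \<notin> sites \<Longrightarrow> snd (\<Gamma> q) = snd q"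
  using \<Gamma>(2)[of q] by (simp add: F_def prod_eq_iff)

lemma Re_A_ext_\<Gamma>: "q \<notin> sites \<Longrightarrow> Re (A_ext (pt (\<Gamma> q))) = fst q"
  using \<Gamma>(2)[of q] by (simp add: F_def prod_eq_iff)

lemma A_ext_pt_deriv:
  assumes "v \<in> domain"
  shows "((\<lambda>w. A_ext (pt w)) has_derivative (\<lambda>h. G_ext (pt v) * pt h)) (at v)"
  using has_derivative_compose[OF bounded_linear_imp_has_derivative[OF bounded_linear_pt]
      A_ext_deriv[of "pt v", unfolded has_field_derivative_def]] assms
  by (simp add: domain_def)

definition D :: "real \<times> real \<Rightarrow> complex" where
  "D q = G_ext (pt (\<Gamma> q))"

lemma Re_D_pos: "q \<notin> sites \<Longrightarrow> Re (D q) > 0"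
  using \<Gamma>(1)[of q] by (auto simp: D_def domain_def intro: Re_G_ext_pos)

text \<open>The Jacobian of \<open>F\<close> is triangular with diagonal entries
  \<open>Re (D q) > 0\<close> and 1, so it can be inverted explicitly.\<close>

lemma \<Gamma>_deriv:
  assumes "q \<notin> sites"
  shows "(\<Gamma> has_derivative (\<lambda>h. ((fst h + Im (D q) * snd h) / Re (D q), snd h))) (at q)"
proof -
  have F': "(F has_derivative (\<lambda>h. (Re (G_ext (pt v) * pt h), snd h))) (at v)" if "v \<in> domain" for v
    unfolding F_def
    by (intro has_derivative_Pair bounded_linear.has_derivative[OF bounded_linear_Re]
        A_ext_pt_deriv that bounded_linear_imp_has_derivative bounded_linear_snd)
  have "(\<Gamma> has_derivative (\<lambda>h. ((fst h + Im (D q) * snd h) / Re (D q), snd h))) (at (F (\<Gamma> q)))"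
  proof (rule has_derivative_inverse_strong[where f = F and x = "\<Gamma> q", OF open_domain])
    show "\<Gamma> q \<in> domain" using \<Gamma> assms by simp
    then show "(F has_derivative (\<lambda>h. (Re (D q * pt h), snd h))) (at (\<Gamma> q))"
      unfolding D_def by (rule F')
    show "continuous_on domain F"
      using F' by (intro continuous_at_imp_continuous_on ballI) (blast intro: has_derivative_continuous)
    show "(\<lambda>h. (Re (D q * pt h), snd h)) \<circ> (\<lambda>h. ((fst h + Im (D q) * snd h) / Re (D q), snd h)) = id"
      using Re_D_pos[OF assms] by (simp add: fun_eq_iff)
  qed (rule \<Gamma>_F)
  then show ?thesis using \<Gamma> assms by simp
qed

lemma continuous_on_\<Gamma>: "continuous_on (- sites) \<Gamma>"
  using \<Gamma>_deriv by (intro continuous_at_imp_continuous_on ballI) (blast intro: has_derivative_continuous)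

lemma continuous_on_D: "continuous_on (- sites) D"
  unfolding D_def
  by (rule continuous_on_compose2[OF continuous_on_G_ext])
     (use \<Gamma>(1) in \<open>auto simp: domain_def intro: bounded_linear.continuous_on[OF bounded_linear_pt continuous_on_\<Gamma>]\<close>)

lemma finite_sites: "finite sites"
  by (simp add: sites_def)

lemma open_off_sites: "open (- sites)"
  using finite_sites finite_imp_closed by blast

text \<open>With \<open>U\<close> the real part of the primitive, dU = x dg - k dy, hence \<phi> = x
  g - U satisfies d\<phi> = g dx + k dy. The second derivatives are then rational in the real and
  imaginary parts of \<open>D\<close>, and the determinant simplifies to 1.\<close>

lemma partial_Legendre_solution:
  obtains \<phi> where "regular_solution \<phi> (- sites)" "\<And>q. q \<notin> sites \<Longrightarrow> partial_x \<phi> q = fst (\<Gamma> q)"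
proof -
  \<comment> \<open>The slit plane is not simply connected, so \<open>A_ext\<close> is integrated in
    the upper half plane only. Reflection then gives a single-valued real part, whatever the
    imaginary constants on the gaps.\<close>
  obtain W where W: "\<And>z. z \<in> closed_half \<inter> (- slits n) \<Longrightarrow>
      (W has_field_derivative A_ext z) (at z within closed_half)"
  proof (rule primitive_closed_half[OF open_gaps _ holomorphic_on_A_ext])
    show "open_half \<subseteq> - slits n" by (auto simp: slits_def)
    fix M
    have "compact (closed_half \<inter> cball 0 M)"
      by (intro closed_Int_compact closed_halfspace_Im_ge compact_cball)
    then have "compact (A ` (closed_half \<inter> cball 0 M))"
      by (intro compact_continuous_image continuous_on_subset[OF continuous_A]) auto
    then obtain C where C: "C > 0" "\<And>z. z \<in> closed_half \<inter> cball 0 M \<Longrightarrow> norm (A z) \<le> C"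
      using compact_imp_bounded bounded_pos by (metis imageI)
    show "\<exists>C. \<forall>z. Im z > 0 \<longrightarrow> norm z \<le> M \<longrightarrow> norm (A_ext z) \<le> C / sqrt (Im z)"
    proof (intro exI allI impI)
      fix z assume z: "Im z > 0" "norm z \<le> M"
      have "Im z \<le> M" using z abs_Im_le_cmod[of z] by linarith
      \<comment> \<open>A bounded function satisfies the inverse square root bound on bounded sets,
        since there \<open>Im z \<le> M\<close>.\<close>
      have "norm (A_ext z) * sqrt (Im z) \<le> C * sqrt M"
        using z C \<open>Im z \<le> M\<close> by (intro mult_mono) (auto simp: A_ext_def reflect_def)
      then show "norm (A_ext z) \<le> C * sqrt M / sqrt (Im z)"
        using z by (simp add: field_simps)
    qed
  qed blast
  define U where "U v = Re (reflect W (pt v))" for v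
  define g where "g q = fst (\<Gamma> q)" for q
  define k where "k q = Im (A_ext (pt (\<Gamma> q)))" for q
  define \<phi> where "\<phi> q = fst q * g q - U (\<Gamma> q)" for q
  define \<Gamma>' where "\<Gamma>' q h = ((fst h + Im (D q) * snd h) / Re (D q), snd h)" for q h :: "real \<times> real"
  have U': "(U has_derivative (\<lambda>h. Re (A_ext (pt v) * pt h))) (at v)" if "v \<in> domain" for v
  proof -
    have v: "pt v \<notin> slits n" using that by (simp add: domain_def)
    have "((\<lambda>w. Re (reflect W w)) has_derivative (\<lambda>h. Re ((if Im (pt v) \<ge> 0 then A_ext (fold_up (pt v))
        else cnj (A_ext (fold_up (pt v)))) * h))) (at (pt v))"
    proof (rule Re_reflect_deriv)
      show "(W has_field_derivative A_ext (fold_up (pt v))) (at (fold_up (pt v)) within closed_half)"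
        using W fold_up_gap[OF v] by blast
      show "Im (A_ext (fold_up (pt v))) = 0" if "Im (pt v) = 0"
        using Im_A_gap[OF v that] that by (simp add: A_ext_def reflect_def fold_up_upper)
    qed
    moreover have "(if Im (pt v) \<ge> 0 then A_ext (fold_up (pt v)) else cnj (A_ext (fold_up (pt v)))) = A_ext (pt v)"
      by (auto simp: A_ext_def reflect_def fold_up_upper fold_up_lower)
    ultimately have "((\<lambda>w. Re (reflect W w)) has_derivative (\<lambda>h. Re (A_ext (pt v) * h))) (at (pt v))"
      by simp
    from has_derivative_compose[OF bounded_linear_imp_has_derivative[OF bounded_linear_pt] this]
    show ?thesis unfolding U_def .
  qed
  have \<Gamma>': "(\<Gamma> has_derivative \<Gamma>' q) (at q)" if "q \<notin> sites" for q
    unfolding \<Gamma>'_def by (rule \<Gamma>_deriv[OF that])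
  have g': "(g has_derivative (\<lambda>h. fst (\<Gamma>' q h))) (at q)" if "q \<notin> sites" for q
    unfolding g_def by (intro bounded_linear.has_derivative[OF bounded_linear_fst] \<Gamma>' that)
  have k': "(k has_derivative (\<lambda>h. Im (D q * pt (\<Gamma>' q h)))) (at q)" if "q \<notin> sites" for q
    unfolding k_def D_def
    using has_derivative_compose[OF \<Gamma>'[OF that] A_ext_pt_deriv[OF \<Gamma>(1)[OF that]]]
    by (rule bounded_linear.has_derivative[OF bounded_linear_Im])
  have \<phi>': "(\<phi> has_derivative (\<lambda>h. g q * fst h + k q * snd h)) (at q)" if "q \<notin> sites" for q
  proof -
    have "(\<phi> has_derivative (\<lambda>h. (fst q * fst (\<Gamma>' q h) + fst h * g q) - Re (A_ext (pt (\<Gamma> q)) * pt (\<Gamma>' q h)))) (at q)"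
      unfolding \<phi>_def
      by (intro has_derivative_diff has_derivative_mult bounded_linear_imp_has_derivative bounded_linear_fst
          g' that has_derivative_compose[OF \<Gamma>'[OF that] U'] \<Gamma>)
    then show ?thesis
      using Re_A_ext_\<Gamma>[OF that] by (simp add: \<Gamma>'_def k_def mult.commute)
  qed
  have "regular_solution \<phi> (- sites)"
  proof (rule regular_solution_has_derivative[where g = g and k = k and r = "\<lambda>q. 1 / Re (D q)"
        and s = "\<lambda>q. Im (D q) / Re (D q)" and t = "\<lambda>q. (Im (D q))\<^sup>2 / Re (D q) + Re (D q)"])
    fix q assume "q \<in> - sites"
    then have q: "q \<notin> sites" and D: "Re (D q) \<noteq> 0" using Re_D_pos[of q] by auto
    show "(\<phi> has_derivative (\<lambda>h. g q * fst h + k q * snd h)) (at q)" by (rule \<phi>'[OF q])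
    show "(g has_derivative (\<lambda>h. 1 / Re (D q) * fst h + Im (D q) / Re (D q) * snd h)) (at q)"
      using g'[OF q] by (simp add: \<Gamma>'_def add_divide_distrib)
    have "(\<lambda>h. Im (D q * pt (\<Gamma>' q h))) = (\<lambda>h. Im (D q) / Re (D q) * fst h + ((Im (D q))\<^sup>2 / Re (D q) + Re (D q)) * snd h)"
      using D by (auto simp: fun_eq_iff \<Gamma>'_def field_simps power2_eq_square)
    with k'[OF q] show "(k has_derivative (\<lambda>h. Im (D q) / Re (D q) * fst h +
        ((Im (D q))\<^sup>2 / Re (D q) + Re (D q)) * snd h)) (at q)" by simp
    show "1 / Re (D q) * ((Im (D q))\<^sup>2 / Re (D q) + Re (D q)) - (Im (D q) / Re (D q))\<^sup>2 = 1"
      using D by (simp add: field_simps power2_eq_square)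
  next
    have "\<forall>q\<in>- sites. Re (D q) \<noteq> 0" using Re_D_pos by force
    then show "continuous_on (- sites) (\<lambda>q. 1 / Re (D q))"
      "continuous_on (- sites) (\<lambda>q. Im (D q) / Re (D q))"
      "continuous_on (- sites) (\<lambda>q. (Im (D q))\<^sup>2 / Re (D q) + Re (D q))"
      by (intro continuous_intros continuous_on_D; simp)+
  qed (rule open_off_sites)
  moreover have "partial_x \<phi> q = fst (\<Gamma> q)" if "q \<notin> sites" for q
  proof -
    have "continuous_on (- sites) g" "continuous_on (- sites) k"
      by (intro continuous_at_imp_continuous_on ballI has_derivative_continuous[OF g']
          has_derivative_continuous[OF k']; simp)+
    from C1_on_has_derivative(2)[OF open_off_sites \<phi>' this, of q] that
    show ?thesis by (simp add: g_def)
  qed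
  ultimately show ?thesis by (rule that)
qed

section \<open>The jump of \<open>\<phi>_x\<close> at the sites\<close>

lemma fst_\<Gamma>_left:
  assumes "j < n" "x < site j" "(x, 0) \<notin> sites"
  shows "fst (\<Gamma> (x, 0)) \<le> 2 * real j"
proof (rule ccontr)
  assume "\<not> ?thesis"
  then have "site j \<le> Re (A (Complex (fst (\<Gamma> (x, 0))) 0))"
    using monoD[OF mono_Re_A[of 0], of "2 * real j" "fst (\<Gamma> (x, 0))"] by (simp add: site_def)
  with assms Re_A_ext_\<Gamma>[of "(x, 0)"] snd_\<Gamma>[of "(x, 0)"] show False
    by (simp add: Re_A_ext)
qed

text \<open>By monotonicity, a preimage left of the right end of the slit would have real part at
  most \<open>site j\<close>. With \<open>fst_\<Gamma>_left\<close>, the first derivative jumps by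
  at least the length of the slit.\<close>

lemma fst_\<Gamma>_right:
  assumes "j < n" "site j < x" "(x, 0) \<notin> sites"
  shows "2 * real j + 1 \<le> fst (\<Gamma> (x, 0))"
proof (rule ccontr)
  assume "\<not> ?thesis"
  then have "Re (A (Complex (fst (\<Gamma> (x, 0))) 0)) \<le> Re (A (Complex (2 * real j + 1) 0))"
    using monoD[OF mono_Re_A[of 0], of "fst (\<Gamma> (x, 0))" "2 * real j + 1"] by simp
  with assms Re_A_ext_\<Gamma>[of "(x, 0)"] snd_\<Gamma>[of "(x, 0)"] Re_A_slit[of j "2 * real j + 1"] show False
    by (simp add: Re_A_ext)
qed

lemma inj_on_site: "inj_on site {..<n}"
proof (rule linorder_inj_onI)
  fix i j assume ij: "i < j" "i \<in> {..<n}" "j \<in> {..<n}"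
  \<comment> \<open>The midpoint of the gap to the right of slit \<open>i\<close>. If the sites were
    equal, monotonicity would give \<open>Re A\<close> the same value at \<open>t\<close> as at the
    left end of slit \<open>i\<close>, against \<open>Re_A_inj\<close>.\<close>
  define t where "t = 2 * real i + 3 / 2"
  have "Complex t 0 \<notin> slits n"
    by (rule open_gap_not_slit[of i]) (auto simp: t_def)
  have le: "2 * real i \<le> t" "t \<le> 2 * real j" using ij(1) by (auto simp: t_def)
  show "site i \<noteq> site j"
  proof
    assume "site i = site j"
    then have "Re (A (Complex (2 * real i) 0)) = Re (A (Complex t 0))"
      using monoD[OF mono_Re_A[of 0] le(1)] monoD[OF mono_Re_A[of 0] le(2)] by (simp add: site_def)
    from Re_A_inj[OF \<open>Complex t 0 \<notin> slits n\<close> order_refl this] show False by (simp add: t_def)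
  qed
qed auto

text \<open>A continuous partial derivative of an extension would have to be at most
  \<open>2 * real j\<close> by approach from the left and at least \<open>2 * real j + 1\<close> by
  approach from the right.\<close>

lemma not_C1_extends_across_site:
  assumes \<phi>: "\<And>q. q \<notin> sites \<Longrightarrow> partial_x \<phi> q = fst (\<Gamma> q)" and "j < n"
  shows "\<not> C1_extends_across \<phi> (site j, 0)"
proof
  define p where "p = (site j, 0 :: real)"
  assume "C1_extends_across \<phi> (site j, 0)"
  then obtain V \<psi> where V: "p \<in> V" "C1_on \<psi> V" "\<And>q. q \<in> V - {p} \<Longrightarrow> \<psi> q = \<phi> q"
    unfolding C1_extends_across_def p_def by blast
  then have "open V" and cont: "continuous_on V (partial_x \<psi>)" by (auto simp: C1_on_def)
  have same_partial: "partial_x \<psi> q = partial_x \<phi> q" if q: "q \<in> V - {p}" for q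
  proof -
    obtain x y where xy: "q = (x, y)" by (cases q)
    have "open (V - {p})" using \<open>open V\<close> by blast
    then have "open ((\<lambda>t. (t, y)) -` (V - {p}))"
      by (rule open_vimage) (intro continuous_intros)
    then have "\<forall>\<^sub>F t in nhds x. (t, y) \<in> V - {p}"
      using q xy eventually_nhds_in_open by force
    then have "\<forall>\<^sub>F t in nhds x. \<psi> (t, y) = \<phi> (t, y)"
      by eventually_elim (rule V(3))
    then show ?thesis unfolding xy partial_x_def by (auto intro: deriv_cong_ev)
  qed
  have \<psi>: "partial_x \<psi> q = fst (\<Gamma> q)" if "q \<in> V - sites" for q
  proof -
    have "p \<in> sites" using \<open>j < n\<close> by (simp add: p_def sites_def)
    with that have "q \<in> V - {p}" by auto
    with same_partial \<phi>[of q] that show ?thesis by simp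
  qed
  have lim: "(\<lambda>m. partial_x \<psi> (q m)) \<longlonglongrightarrow> partial_x \<psi> p" and ev: "\<forall>\<^sub>F m in sequentially. q m \<in> V - sites"
    if "q \<longlonglongrightarrow> p" "\<And>m. q m \<noteq> p" for q :: "nat \<Rightarrow> real \<times> real"
  proof -
    show "(\<lambda>m. partial_x \<psi> (q m)) \<longlonglongrightarrow> partial_x \<psi> p"
      using cont V(1) \<open>open V\<close> that(1) by (auto simp: continuous_on_eq_continuous_at intro: isCont_tendsto_compose)
    \<comment> \<open>The other sites are finitely many, so a sequence tending to \<open>p\<close>
      eventually avoids them.\<close>
    have "open (V - (sites - {p}))"
      using \<open>open V\<close> finite_sites by (intro open_Diff finite_imp_closed) auto
    then have "\<forall>\<^sub>F m in sequentially. q m \<in> V - (sites - {p})"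
      using that(1) V(1) by (intro topological_tendstoD) auto
    then show "\<forall>\<^sub>F m in sequentially. q m \<in> V - sites"
      by eventually_elim (use that(2) in auto)
  qed
  define l where "l m = (site j - inverse (real (Suc m)), 0 :: real)" for m
  define r where "r m = (site j + inverse (real (Suc m)), 0 :: real)" for m
  have "l \<longlonglongrightarrow> (site j - 0, 0)" "r \<longlonglongrightarrow> (site j + 0, 0)"
    unfolding l_def r_def by (intro tendsto_intros LIMSEQ_inverse_real_of_nat)+
  then have l: "l \<longlonglongrightarrow> p" "\<And>m. l m \<noteq> p" and r: "r \<longlonglongrightarrow> p" "\<And>m. r m \<noteq> p"
    by (simp_all add: p_def l_def r_def del: of_nat_Suc)
  have "partial_x \<psi> p \<le> 2 * real j"
  proof (rule tendsto_upperbound[OF lim[OF l]])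
    show "\<forall>\<^sub>F m in sequentially. partial_x \<psi> (l m) \<le> 2 * real j"
      using ev[OF l] by eventually_elim (use \<psi> fst_\<Gamma>_left \<open>j < n\<close> in \<open>simp add: l_def del: of_nat_Suc\<close>)
  qed simp
  moreover have "2 * real j + 1 \<le> partial_x \<psi> p"
  proof (rule tendsto_lowerbound[OF lim[OF r]])
    show "\<forall>\<^sub>F m in sequentially. 2 * real j + 1 \<le> partial_x \<psi> (r m)"
      using ev[OF r] by eventually_elim (use \<psi> fst_\<Gamma>_right \<open>j < n\<close> in \<open>simp add: r_def del: of_nat_Suc\<close>)
  qed simp
  ultimately show False by linarith
qed

end

theorem theorem2:
  fixes n :: nat
  assumes "n \<ge> 1"
  shows "\<exists>(p :: nat \<Rightarrow> real \<times> real) (\<phi> :: real \<times> real \<Rightarrow> real).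
           inj_on p {1..n} \<and>
           regular_solution \<phi> (UNIV - p ` {1..n}) \<and>
           (\<forall>j\<in>{1..n}. nonremovable_isolated_singularity \<phi> (p j))"
proof -
  obtain A c where c: "\<And>j. j < n \<Longrightarrow> 2 * real j < c j \<and> c j < 2 * real j + 1"
    and A: "continuous_on closed_half A" "A 0 = 0"
    "\<And>z. z \<in> closed_half - of_nat ` {..<2 * n} \<Longrightarrow>
       (A has_field_derivative (\<Prod>j<n. z - of_real (c j)) / root_prod n z) (at z within closed_half)"
    "\<And>j. j < n \<Longrightarrow> Im (A (of_nat (2 * j + 1))) = Im (A (of_nat (2 * j)))"
    using slit_map_primitive[OF assms] by metis
  interpret slit_weights n c by unfold_locales (use assms c in auto)
  interpret comb_map n c A
    by unfold_locales (use A in \<open>auto simp: G_def\<close>)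
  obtain \<phi> where \<phi>: "regular_solution \<phi> (- sites)" "\<And>q. q \<notin> sites \<Longrightarrow> partial_x \<phi> q = fst (\<Gamma> q)"
    using partial_Legendre_solution by blast
  \<comment> \<open>The points are numbered from 1, the sites from 0.\<close>
  define p where "p i = (site (i - 1), 0 :: real)" for i
  have "inj_on p {1..n}"
    unfolding image_Suc_lessThan[symmetric] using inj_on_site by (auto simp: inj_on_def p_def)
  have image: "p ` {1..n} = sites"
    unfolding image_Suc_lessThan[symmetric] by (simp add: sites_def p_def image_image)
  have "nonremovable_isolated_singularity \<phi> (p j)" if j: "j \<in> {1..n}" for j
    unfolding nonremovable_isolated_singularity_def
  proof
    show "\<not> C1_extends_across \<phi> (p j)"
      unfolding p_def by (rule not_C1_extends_across_site) (use \<phi> j in auto)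
    have "open (- (sites - {p j}))"
      using finite_sites by (intro open_Compl finite_imp_closed) auto
    then obtain r where r: "r > 0" "ball (p j) r \<subseteq> - (sites - {p j})"
      by (metis ComplI DiffD2 insertI1 openE)
    then show "isolated_singularity \<phi> (p j)"
      unfolding isolated_singularity_def
      by (intro exI[of _ r] conjI regular_solution_subset[OF \<phi>(1)]) auto
  qed
  with \<open>inj_on p {1..n}\<close> \<phi>(1) image show ?thesis
    unfolding Compl_eq_Diff_UNIV[symmetric] by metis
qed

end
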